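(* Let $X$ be a real infinite-dimensional $L_1$-predual and let $Y$ be any non-zero real Banach space. Then the projective tensor product $X\widehat{\otimes}_\pi Y$ has the diameter two property (D2P).
   Context: All Banach spaces are real. $B_Z$ denotes the closed unit ball of a Banach space $Z$. An $L_1$-predual is a Banach space $X$ whose dual $X^*$ is isometrically isomorphic to $L_1(\mu)$ for some measure $\mu$. D2P: a Banach space $Z$ has the diameter two property (D2P) if every non-empty relatively weakly open subset of $B_Z$ has diameter exactly two. Projective tensor product: $X\widehat{\otimes}_\pi Y$ is the completion of the algebraic tensor product $X\otimes Y$ under the norm $\|z\|_\pi=\inf\{\sum_{n=1}^k\|x_n\|\|y_n\|: z=\sum_{n=1}^k x_n\otimes y_n\}$, the infimum being over all such representations of $z$. *)

theory Defs
  imports "HOL-Analysis.Analysis"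
begin

section \<open>The algebraic tensor product\<close>

text \<open>
  Elements are represented by formal sums, the list \<open>[(x\<^sub>1, y\<^sub>1), \<dots>, (x\<^sub>k, y\<^sub>k)]\<close> standing for
  \<open>x\<^sub>1 \<otimes> y\<^sub>1 + \<dots> + x\<^sub>k \<otimes> y\<^sub>k\<close>. As usual in Banach space theory, a tensor is viewed as a linear
  functional on the space of all (not necessarily bounded) bilinear forms, with
  \<open>(x \<otimes> y)(A) = A x y\<close>: two formal sums denote the same tensor iff these functionals agree.
\<close>

definition tensor_eval :: "('a::real_vector \<times> 'b::real_vector) list \<Rightarrow> ('a \<Rightarrow> 'b \<Rightarrow> real) \<Rightarrow> real"
  where "tensor_eval zs A = (\<Sum>(x, y)\<leftarrow>zs. A x y)"

definition tensor_eq ::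
    "('a::real_vector \<times> 'b::real_vector) list \<Rightarrow> ('a \<times> 'b) list \<Rightarrow> bool"
  where "tensor_eq zs ws \<longleftrightarrow> (\<forall>A. bilinear A \<longrightarrow> tensor_eval zs A = tensor_eval ws A)"

quotient_type (overloaded) ('a, 'b) tensor =
    "('a::real_vector \<times> 'b::real_vector) list" / tensor_eq
  by (rule equivpI) (auto simp: reflp_def symp_def transp_def tensor_eq_def)

lemma tensor_eval_simps [simp]:
  "tensor_eval [] A = 0"
  "tensor_eval ((x, y) # zs) A = A x y + tensor_eval zs A"
  "tensor_eval (zs @ ws) A = tensor_eval zs A + tensor_eval ws A"
  by (simp_all add: tensor_eval_def)

lemma tensor_eval_scale:
  assumes "bilinear A"
  shows "tensor_eval (map (\<lambda>(x, y). (c *\<^sub>R x, y)) zs) A = c * tensor_eval zs A"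
  using assms by (induction zs) (auto simp: bilinear_lmul distrib_left)

instantiation tensor :: (real_vector, real_vector) real_vector
begin

lift_definition zero_tensor :: "('a, 'b) tensor" is "[]" .

lift_definition plus_tensor :: "('a, 'b) tensor \<Rightarrow> ('a, 'b) tensor \<Rightarrow> ('a, 'b) tensor" is "(@)"
  by (simp add: tensor_eq_def)

lift_definition scaleR_tensor :: "real \<Rightarrow> ('a, 'b) tensor \<Rightarrow> ('a, 'b) tensor"
  is "\<lambda>c. map (\<lambda>(x, y). (c *\<^sub>R x, y))"
  by (simp add: tensor_eq_def tensor_eval_scale)

definition uminus_tensor :: "('a, 'b) tensor \<Rightarrow> ('a, 'b) tensor"
  where "uminus_tensor u = (-1) *\<^sub>R u"

definition minus_tensor :: "('a, 'b) tensor \<Rightarrow> ('a, 'b) tensor \<Rightarrow> ('a, 'b) tensor"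
  where "minus_tensor u v = u + (- v)"

instance
proof
  fix a b c :: "('a, 'b) tensor" and r s :: real
  show "a + b + c = a + (b + c)"
    by transfer (simp add: tensor_eq_def)
  show "a + b = b + a"
    by transfer (simp add: tensor_eq_def)
  show "0 + a = a"
    by transfer (simp add: tensor_eq_def)
  show "- a + a = 0"
    unfolding uminus_tensor_def
    by transfer (simp add: tensor_eq_def tensor_eval_scale[where c = "-1", simplified])
  show "a - b = a + - b"
    by (rule minus_tensor_def)
  show "r *\<^sub>R (a + b) = r *\<^sub>R a + r *\<^sub>R b"
    by transfer (simp add: tensor_eq_def)
  show "(r + s) *\<^sub>R a = r *\<^sub>R a + s *\<^sub>R a"
    by transfer (simp add: tensor_eq_def tensor_eval_scale distrib_right)
  show "r *\<^sub>R s *\<^sub>R a = (r * s) *\<^sub>R a"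
    by transfer (simp add: tensor_eq_def tensor_eval_scale del: map_map)
  show "1 *\<^sub>R a = a"
    by transfer (simp add: tensor_eq_def tensor_eval_scale)
qed

end

lift_definition elem_tensor :: "'a::real_vector \<Rightarrow> 'b::real_vector \<Rightarrow> ('a, 'b) tensor"
    (infixr \<open>\<otimes>\<^sub>t\<close> 75)
  is "\<lambda>x y. [(x, y)]" .

lemma sum_list_elem_tensor:
  "(\<Sum>(x, y)\<leftarrow>zs. x \<otimes>\<^sub>t y) = abs_tensor zs"
proof (induction zs)
  case Nil
  then show ?case by (simp add: zero_tensor.abs_eq)
next
  case (Cons z zs)
  then show ?case
    by (cases z) (simp add: elem_tensor.abs_eq plus_tensor.abs_eq)
qed

lemma tensor_representation: "\<exists>zs. u = (\<Sum>(x, y)\<leftarrow>zs. x \<otimes>\<^sub>t y)"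
  unfolding sum_list_elem_tensor by (metis Quotient3_abs_rep[OF Quotient3_tensor])

lemma scaleR_elem_tensor_sum:
  "c *\<^sub>R (\<Sum>(x, y)\<leftarrow>zs. x \<otimes>\<^sub>t y) = (\<Sum>(x, y)\<leftarrow>map (\<lambda>(x, y). (c *\<^sub>R x, y)) zs. x \<otimes>\<^sub>t y)"
  unfolding sum_list_elem_tensor by (simp add: scaleR_tensor.abs_eq)

section \<open>The projective norm\<close>

definition proj_norm :: "('a::real_normed_vector, 'b::real_normed_vector) tensor \<Rightarrow> real"
  where "proj_norm z =
    Inf {(\<Sum>(x, y)\<leftarrow>zs. norm x * norm y) | zs. z = (\<Sum>(x, y)\<leftarrow>zs. x \<otimes>\<^sub>t y)}"

lemma rep_cost_nonneg: "0 \<le> (\<Sum>(x, y)\<leftarrow>zs. norm x * norm y)"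
  by (rule sum_list_nonneg) auto

lemma proj_norm_le: "proj_norm (\<Sum>(x, y)\<leftarrow>zs. x \<otimes>\<^sub>t y) \<le> (\<Sum>(x, y)\<leftarrow>zs. norm x * norm y)"
  unfolding proj_norm_def
  by (rule cInf_lower) (auto intro!: bdd_belowI[where m = 0] rep_cost_nonneg)

lemma proj_norm_approx:
  assumes "e > 0"
  obtains zs where "u = (\<Sum>(x, y)\<leftarrow>zs. x \<otimes>\<^sub>t y)"
    "(\<Sum>(x, y)\<leftarrow>zs. norm x * norm y) < proj_norm u + e"
proof -
  let ?S = "{(\<Sum>(x, y)\<leftarrow>zs. norm x * norm y) | zs. u = (\<Sum>(x, y)\<leftarrow>zs. x \<otimes>\<^sub>t y)}"
  have "?S \<noteq> {}" using tensor_representation[of u] by auto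
  moreover have "Inf ?S < proj_norm u + e" using assms by (simp add: proj_norm_def)
  ultimately obtain r where "r \<in> ?S" "r < proj_norm u + e" by (rule cInf_lessD[THEN bexE]) auto
  then show thesis using that by auto
qed

lemma proj_norm_nonneg [simp]: "0 \<le> proj_norm u"
  unfolding proj_norm_def
  using tensor_representation[of u] by (intro cInf_greatest) (auto intro: rep_cost_nonneg)

lemma proj_norm_zero [simp]: "proj_norm (0 :: ('a::real_normed_vector, 'b::real_normed_vector) tensor) = 0"
  by (rule antisym) (use proj_norm_le[of "[] :: ('a \<times> 'b) list"] in simp_all)

lemma proj_norm_triangle: "proj_norm (u + v) \<le> proj_norm u + proj_norm v"
proof (rule field_le_epsilon)
  fix e :: real assume "e > 0"
  then have e: "e / 2 > 0" by simp
  obtain zs where zs: "u = (\<Sum>(x, y)\<leftarrow>zs. x \<otimes>\<^sub>t y)"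
    "(\<Sum>(x, y)\<leftarrow>zs. norm x * norm y) < proj_norm u + e / 2"
    using proj_norm_approx[OF e] .
  obtain ws where ws: "v = (\<Sum>(x, y)\<leftarrow>ws. x \<otimes>\<^sub>t y)"
    "(\<Sum>(x, y)\<leftarrow>ws. norm x * norm y) < proj_norm v + e / 2"
    using proj_norm_approx[OF e] .
  show "proj_norm (u + v) \<le> proj_norm u + proj_norm v + e"
    using proj_norm_le[of "zs @ ws"] zs ws by simp
qed

lemma proj_norm_scaleR_le: "proj_norm (c *\<^sub>R u) \<le> \<bar>c\<bar> * proj_norm u"
proof (rule field_le_epsilon)
  fix e :: real assume "e > 0"
  then have e: "e / (\<bar>c\<bar> + 1) > 0" by simp
  obtain zs where zs: "u = (\<Sum>(x, y)\<leftarrow>zs. x \<otimes>\<^sub>t y)"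
    "(\<Sum>(x, y)\<leftarrow>zs. norm x * norm y) < proj_norm u + e / (\<bar>c\<bar> + 1)"
    using proj_norm_approx[OF e] .
  have "(\<Sum>(x, y)\<leftarrow>map (\<lambda>(x, y). (c *\<^sub>R x, y)) ws. norm x * norm y)
      = \<bar>c\<bar> * (\<Sum>(x, y)\<leftarrow>ws. norm x * norm y)" for ws :: "('a \<times> 'b) list"
    by (induction ws) (auto simp: distrib_left)
  then have "proj_norm (c *\<^sub>R u) \<le> \<bar>c\<bar> * (\<Sum>(x, y)\<leftarrow>zs. norm x * norm y)"
    using proj_norm_le[of "map (\<lambda>(x, y). (c *\<^sub>R x, y)) zs"]
    by (simp only: zs(1) scaleR_elem_tensor_sum)
  also have "\<dots> \<le> \<bar>c\<bar> * (proj_norm u + e / (\<bar>c\<bar> + 1))"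
    using zs(2) by (intro mult_left_mono) auto
  also have "\<dots> \<le> \<bar>c\<bar> * proj_norm u + e"
    using \<open>e > 0\<close> by (simp add: field_simps)
  finally show "proj_norm (c *\<^sub>R u) \<le> \<bar>c\<bar> * proj_norm u + e" .
qed

lemma proj_norm_scaleR [simp]: "proj_norm (c *\<^sub>R u) = \<bar>c\<bar> * proj_norm u"
proof (cases "c = 0")
  case False
  have "\<bar>c\<bar> * proj_norm u = \<bar>c\<bar> * proj_norm (inverse c *\<^sub>R c *\<^sub>R u)" using False by simp
  also have "\<dots> \<le> \<bar>c\<bar> * (\<bar>inverse c\<bar> * proj_norm (c *\<^sub>R u))"
    by (intro mult_left_mono proj_norm_scaleR_le) auto
  also have "\<dots> = proj_norm (c *\<^sub>R u)"
    using False by (simp add: field_simps abs_inverse)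
  finally show ?thesis using proj_norm_scaleR_le[of c u] by simp
qed simp

lemma proj_norm_minus [simp]: "proj_norm (- u) = proj_norm u"
  using proj_norm_scaleR[of "-1" u] by simp

lemma proj_norm_minus_commute: "proj_norm (u - v) = proj_norm (v - u)"
  using proj_norm_minus[of "u - v"] by simp

lemma proj_norm_triangle_sub: "\<bar>proj_norm u - proj_norm v\<bar> \<le> proj_norm (u - v)"
  using proj_norm_triangle[of "u - v" v] proj_norm_triangle[of "v - u" u]
  by (simp add: proj_norm_minus_commute[of v u])

lemma proj_norm_triangle4: "proj_norm ((u + v) - (u' + v')) \<le> proj_norm (u - u') + proj_norm (v - v')"
  using proj_norm_triangle[of "u - u'" "v - v'"] by (simp add: algebra_simps)

section \<open>The projective tensor product\<close>

text \<open>
  The completion is formed by Cauchy sequences modulo sequences tending to zero.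
  This uses only that \<^const>\<open>proj_norm\<close> is a seminorm, so its definiteness is not needed here.
\<close>

definition proj_cauchy ::
    "(nat \<Rightarrow> ('a::real_normed_vector, 'b::real_normed_vector) tensor) \<Rightarrow> bool"
  where "proj_cauchy u \<longleftrightarrow> (\<forall>e>0. \<exists>N. \<forall>m\<ge>N. \<forall>n\<ge>N. proj_norm (u m - u n) < e)"

definition proj_rel ::
    "(nat \<Rightarrow> ('a::real_normed_vector, 'b::real_normed_vector) tensor) \<Rightarrow>
      (nat \<Rightarrow> ('a, 'b) tensor) \<Rightarrow> bool"
  where "proj_rel u v \<longleftrightarrow> proj_cauchy u \<and> proj_cauchy v \<and> (\<lambda>n. proj_norm (u n - v n)) \<longlonglongrightarrow> 0"

lemma proj_cauchy_const [simp]: "proj_cauchy (\<lambda>_. u)"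
  by (simp add: proj_cauchy_def)

lemma proj_rel_refl: "proj_cauchy u \<Longrightarrow> proj_rel u u"
  by (simp add: proj_rel_def)

lemma proj_rel_sym: "proj_rel u v \<Longrightarrow> proj_rel v u"
  by (simp add: proj_rel_def proj_norm_minus_commute)

lemma proj_rel_trans:
  assumes "proj_rel u v" "proj_rel v w"
  shows "proj_rel u w"
proof -
  have lim: "(\<lambda>n. proj_norm (u n - v n) + proj_norm (v n - w n)) \<longlonglongrightarrow> 0"
    using assms tendsto_add[of "\<lambda>n. proj_norm (u n - v n)" 0 sequentially "\<lambda>n. proj_norm (v n - w n)" 0]
    by (simp add: proj_rel_def)
  have "(\<lambda>n. proj_norm (u n - w n)) \<longlonglongrightarrow> 0"
  proof (rule tendsto_sandwich[OF _ _ tendsto_const lim])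
    show "\<forall>\<^sub>F n in sequentially. proj_norm (u n - w n) \<le> proj_norm (u n - v n) + proj_norm (v n - w n)"
      using proj_norm_triangle[of "u n - v n" "v n - w n" for n] by simp
  qed simp
  then show ?thesis using assms by (simp add: proj_rel_def)
qed

quotient_type (overloaded) ('a, 'b) proj_tensor =
    "nat \<Rightarrow> ('a::real_normed_vector, 'b::real_normed_vector) tensor" / partial: proj_rel
proof (rule part_equivpI)
  show "\<exists>u. proj_rel u u" using proj_rel_refl[OF proj_cauchy_const] by blast
qed (auto intro!: sympI transpI intro: proj_rel_sym proj_rel_trans)

lemma proj_cauchy_add:
  assumes "proj_cauchy u" "proj_cauchy v"
  shows "proj_cauchy (\<lambda>n. u n + v n)"
  unfolding proj_cauchy_def
proof (intro allI impI)
  fix e :: real assume "e > 0"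
  then have e: "e / 2 > 0" by simp
  obtain M where M: "\<And>m n. m \<ge> M \<Longrightarrow> n \<ge> M \<Longrightarrow> proj_norm (u m - u n) < e / 2"
    using assms(1) e unfolding proj_cauchy_def by blast
  obtain N where N: "\<And>m n. m \<ge> N \<Longrightarrow> n \<ge> N \<Longrightarrow> proj_norm (v m - v n) < e / 2"
    using assms(2) e unfolding proj_cauchy_def by blast
  have "proj_norm ((u m + v m) - (u n + v n)) < e" if "m \<ge> max M N" "n \<ge> max M N" for m n
    using M[of m n] N[of m n] that proj_norm_triangle4[of "u m" "v m" "u n" "v n"] by simp
  then show "\<exists>N. \<forall>m\<ge>N. \<forall>n\<ge>N. proj_norm (u m + v m - (u n + v n)) < e" by blast
qed

lemma proj_cauchy_scaleR:
  assumes "proj_cauchy u"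
  shows "proj_cauchy (\<lambda>n. c *\<^sub>R u n)"
  unfolding proj_cauchy_def
proof (intro allI impI)
  fix e :: real assume "e > 0"
  then have "e / (\<bar>c\<bar> + 1) > 0" by simp
  then obtain N where N: "\<And>m n. m \<ge> N \<Longrightarrow> n \<ge> N \<Longrightarrow> proj_norm (u m - u n) < e / (\<bar>c\<bar> + 1)"
    using assms unfolding proj_cauchy_def by blast
  have "proj_norm (c *\<^sub>R u m - c *\<^sub>R u n) < e" if "m \<ge> N" "n \<ge> N" for m n
  proof -
    have "proj_norm (c *\<^sub>R u m - c *\<^sub>R u n) = \<bar>c\<bar> * proj_norm (u m - u n)"
      by (simp flip: scaleR_diff_right)
    also have "\<dots> \<le> \<bar>c\<bar> * (e / (\<bar>c\<bar> + 1))"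
      using N[OF that] by (intro mult_left_mono) auto
    also have "\<dots> < e" using \<open>e > 0\<close> by (simp add: field_simps)
    finally show ?thesis .
  qed
  then show "\<exists>N. \<forall>m\<ge>N. \<forall>n\<ge>N. proj_norm (c *\<^sub>R u m - c *\<^sub>R u n) < e" by blast
qed

lemma proj_rel_add:
  assumes "proj_rel u u'" "proj_rel v v'"
  shows "proj_rel (\<lambda>n. u n + v n) (\<lambda>n. u' n + v' n)"
proof -
  have lim: "(\<lambda>n. proj_norm (u n - u' n) + proj_norm (v n - v' n)) \<longlonglongrightarrow> 0"
    using assms tendsto_add[of "\<lambda>n. proj_norm (u n - u' n)" 0 sequentially "\<lambda>n. proj_norm (v n - v' n)" 0]
    by (simp add: proj_rel_def)
  have "(\<lambda>n. proj_norm ((u n + v n) - (u' n + v' n))) \<longlonglongrightarrow> 0"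
    by (rule tendsto_sandwich[OF _ _ tendsto_const lim]) (simp_all add: proj_norm_triangle4)
  then show ?thesis using assms by (simp add: proj_rel_def proj_cauchy_add)
qed

lemma proj_rel_scaleR:
  assumes "proj_rel u v"
  shows "proj_rel (\<lambda>n. c *\<^sub>R u n) (\<lambda>n. c *\<^sub>R v n)"
proof -
  have "(\<lambda>n. \<bar>c\<bar> * proj_norm (u n - v n)) \<longlonglongrightarrow> 0"
    using assms tendsto_mult_left[of "\<lambda>n. proj_norm (u n - v n)" 0 sequentially "\<bar>c\<bar>"]
    by (simp add: proj_rel_def)
  then show ?thesis
    using assms by (simp add: proj_rel_def proj_cauchy_scaleR flip: scaleR_diff_right)
qed

lemma proj_cauchy_norm_LIMSEQ:
  assumes "proj_cauchy u"
  shows "(\<lambda>n. proj_norm (u n)) \<longlonglongrightarrow> lim (\<lambda>n. proj_norm (u n))"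
proof -
  have "Cauchy (\<lambda>n. proj_norm (u n))"
    unfolding Cauchy_def dist_real_def
    using assms proj_norm_triangle_sub[of "u m" "u n" for m n] unfolding proj_cauchy_def
    by (meson order.strict_trans1)
  then show ?thesis
    by (simp add: Cauchy_convergent convergent_LIMSEQ_iff[symmetric])
qed

lemma proj_rel_norm:
  assumes "proj_rel u v"
  shows "lim (\<lambda>n. proj_norm (u n)) = lim (\<lambda>n. proj_norm (v n))"
proof -
  have "(\<lambda>n. proj_norm (u n) - proj_norm (v n)) \<longlonglongrightarrow> 0"
  proof (rule Lim_null_comparison)
    show "\<forall>\<^sub>F n in sequentially. norm (proj_norm (u n) - proj_norm (v n)) \<le> proj_norm (u n - v n)"
      by (simp add: proj_norm_triangle_sub)
  qed (use assms in \<open>simp add: proj_rel_def\<close>)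
  moreover have "(\<lambda>n. proj_norm (u n) - proj_norm (v n)) \<longlonglongrightarrow>
      lim (\<lambda>n. proj_norm (u n)) - lim (\<lambda>n. proj_norm (v n))"
    using assms by (intro tendsto_diff proj_cauchy_norm_LIMSEQ) (auto simp: proj_rel_def)
  ultimately show ?thesis using LIMSEQ_unique by fastforce
qed

instantiation proj_tensor :: (real_normed_vector, real_normed_vector) real_normed_vector
begin

lift_definition zero_proj_tensor :: "('a, 'b) proj_tensor" is "\<lambda>_. 0"
  by (simp add: proj_rel_refl)

lift_definition plus_proj_tensor ::
    "('a, 'b) proj_tensor \<Rightarrow> ('a, 'b) proj_tensor \<Rightarrow> ('a, 'b) proj_tensor"
  is "\<lambda>u v n. u n + v n"
  by (rule proj_rel_add)

lift_definition scaleR_proj_tensor :: "real \<Rightarrow> ('a, 'b) proj_tensor \<Rightarrow> ('a, 'b) proj_tensor"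
  is "\<lambda>c u n. c *\<^sub>R u n"
  by (rule proj_rel_scaleR)

lift_definition norm_proj_tensor :: "('a, 'b) proj_tensor \<Rightarrow> real"
  is "\<lambda>u. lim (\<lambda>n. proj_norm (u n))"
  by (rule proj_rel_norm)

definition uminus_proj_tensor :: "('a, 'b) proj_tensor \<Rightarrow> ('a, 'b) proj_tensor"
  where "uminus_proj_tensor z = (-1) *\<^sub>R z"

definition minus_proj_tensor ::
    "('a, 'b) proj_tensor \<Rightarrow> ('a, 'b) proj_tensor \<Rightarrow> ('a, 'b) proj_tensor"
  where "minus_proj_tensor z w = z + (- w)"

definition dist_proj_tensor :: "('a, 'b) proj_tensor \<Rightarrow> ('a, 'b) proj_tensor \<Rightarrow> real"
  where "dist_proj_tensor z w = norm (z - w)"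

definition sgn_proj_tensor :: "('a, 'b) proj_tensor \<Rightarrow> ('a, 'b) proj_tensor"
  where "sgn_proj_tensor z = inverse (norm z) *\<^sub>R z"

definition uniformity_proj_tensor :: "(('a, 'b) proj_tensor \<times> ('a, 'b) proj_tensor) filter"
  where "uniformity_proj_tensor = (INF e\<in>{0<..}. principal {(z, w). dist z w < e})"

definition open_proj_tensor :: "('a, 'b) proj_tensor set \<Rightarrow> bool"
  where "open_proj_tensor S \<longleftrightarrow> (\<forall>z\<in>S. \<forall>\<^sub>F (z', w) in uniformity. z' = z \<longrightarrow> w \<in> S)"

instance
proof
  fix a b c :: "('a, 'b) proj_tensor" and r s :: real
  show "a + b + c = a + (b + c)"
    by transfer (auto simp: add.assoc proj_rel_def proj_cauchy_add)
  show "a + b = b + a"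
    by transfer (auto simp: add.commute proj_rel_def proj_cauchy_add)
  show "0 + a = a"
    by transfer (auto simp: proj_rel_def)
  show "- a + a = 0"
    unfolding uminus_proj_tensor_def
    by transfer (auto simp: proj_rel_def)
  show "a - b = a + - b"
    by (rule minus_proj_tensor_def)
  show "r *\<^sub>R (a + b) = r *\<^sub>R a + r *\<^sub>R b"
    by transfer (auto simp: scaleR_add_right proj_rel_def proj_cauchy_add proj_cauchy_scaleR)
  show "(r + s) *\<^sub>R a = r *\<^sub>R a + s *\<^sub>R a"
    by transfer (auto simp: scaleR_add_left proj_rel_def proj_cauchy_add proj_cauchy_scaleR)
  show "r *\<^sub>R s *\<^sub>R a = (r * s) *\<^sub>R a"
    by transfer (auto simp: proj_rel_def proj_cauchy_scaleR)
  show "1 *\<^sub>R a = a"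
    by transfer (auto simp: proj_rel_def)
  show "dist a b = norm (a - b)"
    by (rule dist_proj_tensor_def)
  show "sgn a = inverse (norm a) *\<^sub>R a"
    by (rule sgn_proj_tensor_def)
  show "uniformity = (INF e\<in>{0<..}. principal {(z, w :: ('a, 'b) proj_tensor). dist z w < e})"
    by (rule uniformity_proj_tensor_def)
  show "open U \<longleftrightarrow> (\<forall>z\<in>U. \<forall>\<^sub>F (z', w) in uniformity. z' = z \<longrightarrow> w \<in> U)"
    for U :: "('a, 'b) proj_tensor set"
    by (rule open_proj_tensor_def)
  show "norm a = 0 \<longleftrightarrow> a = 0"
  proof transfer
    fix u :: "nat \<Rightarrow> ('a, 'b) tensor"
    assume "proj_rel u u"
    then have "proj_cauchy u" by (simp add: proj_rel_def)
    then show "lim (\<lambda>n. proj_norm (u n)) = 0 \<longleftrightarrow> proj_rel u (\<lambda>_. 0)"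
      using proj_cauchy_norm_LIMSEQ[of u] by (metis (no_types, lifting) diff_zero ext limI proj_cauchy_const proj_rel_def)
  qed
  show "norm (a + b) \<le> norm a + norm b"
  proof transfer
    fix u v :: "nat \<Rightarrow> ('a, 'b) tensor"
    assume "proj_rel u u" "proj_rel v v"
    then have uv: "proj_cauchy u" "proj_cauchy v" by (simp_all add: proj_rel_def)
    show "lim (\<lambda>n. proj_norm (u n + v n)) \<le> lim (\<lambda>n. proj_norm (u n)) + lim (\<lambda>n. proj_norm (v n))"
      by (rule LIMSEQ_le[OF proj_cauchy_norm_LIMSEQ[OF proj_cauchy_add[OF uv]]
            tendsto_add[OF uv[THEN proj_cauchy_norm_LIMSEQ]]])
        (simp add: proj_norm_triangle)
  qed
  show "norm (r *\<^sub>R a) = \<bar>r\<bar> * norm a"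
  proof transfer
    fix r :: real and u :: "nat \<Rightarrow> ('a, 'b) tensor"
    assume "proj_rel u u"
    then have "proj_cauchy u" by (simp add: proj_rel_def)
    then show "lim (\<lambda>n. proj_norm (r *\<^sub>R u n)) = \<bar>r\<bar> * lim (\<lambda>n. proj_norm (u n))"
      by (intro limI) (simp add: proj_cauchy_norm_LIMSEQ tendsto_mult_left)
  qed
qed

end

definition to_proj_tensor ::
    "('a::real_normed_vector, 'b::real_normed_vector) tensor \<Rightarrow> ('a, 'b) proj_tensor"
  where "to_proj_tensor u = abs_proj_tensor (\<lambda>_. u)"

lemma norm_to_proj_tensor: "norm (to_proj_tensor u) = proj_norm u"
  by (simp add: to_proj_tensor_def norm_proj_tensor.abs_eq proj_rel_refl
      limI[OF tendsto_const])

lemma minus_proj_tensor_abs: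
  assumes "proj_cauchy u" "proj_cauchy v"
  shows "abs_proj_tensor u - abs_proj_tensor v = abs_proj_tensor (\<lambda>n. u n - v n)"
proof -
  have neg: "proj_cauchy (\<lambda>n. - v n)"
    using proj_cauchy_scaleR[OF assms(2), of "-1"] by simp
  have "- abs_proj_tensor v = abs_proj_tensor (\<lambda>n. - v n)"
    unfolding uminus_proj_tensor_def
    using assms(2) by (subst scaleR_proj_tensor.abs_eq) (simp_all add: proj_rel_refl)
  then show ?thesis
    using assms(1) neg
    by (simp add: minus_proj_tensor_def plus_proj_tensor.abs_eq proj_rel_refl)
qed

lemma to_proj_tensor_diff: "to_proj_tensor (u - v) = to_proj_tensor u - to_proj_tensor v"
  by (simp add: to_proj_tensor_def minus_proj_tensor_abs)

lemma to_proj_tensor_LIMSEQ: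
  assumes "proj_cauchy u"
  shows "(\<lambda>n. to_proj_tensor (u n)) \<longlonglongrightarrow> abs_proj_tensor u"
  unfolding LIMSEQ_iff
proof (intro allI impI)
  fix e :: real assume "e > 0"
  then have "e / 2 > 0" by simp
  then obtain N where N: "\<And>m n. m \<ge> N \<Longrightarrow> n \<ge> N \<Longrightarrow> proj_norm (u m - u n) < e / 2"
    using assms unfolding proj_cauchy_def by blast
  have "norm (to_proj_tensor (u m) - abs_proj_tensor u) < e" if "m \<ge> N" for m
  proof -
    have cauchy: "proj_cauchy (\<lambda>n. u m - u n)"
      using proj_cauchy_add[OF proj_cauchy_const proj_cauchy_scaleR[OF assms, of "-1"], of "u m"]
      by simp
    have "norm (to_proj_tensor (u m) - abs_proj_tensor u) = lim (\<lambda>n. proj_norm (u m - u n))"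
      using assms cauchy
      by (simp add: to_proj_tensor_def minus_proj_tensor_abs norm_proj_tensor.abs_eq proj_rel_refl)
    also have "\<dots> \<le> e / 2"
      by (rule LIMSEQ_le_const2[OF proj_cauchy_norm_LIMSEQ[OF cauchy]])
        (use N[OF that] in \<open>meson less_imp_le\<close>)
    finally show ?thesis using \<open>e > 0\<close> by simp
  qed
  then show "\<exists>N. \<forall>n\<ge>N. norm (to_proj_tensor (u n) - abs_proj_tensor u) < e" by blast
qed

lemma to_proj_tensor_dense:
  assumes "e > 0"
  shows "\<exists>u. norm (z - to_proj_tensor u) < e"
proof -
  obtain u where u: "proj_cauchy u" "z = abs_proj_tensor u"
    by (induction z) (auto simp: proj_rel_def)
  from to_proj_tensor_LIMSEQ[OF u(1)] assms show ?thesis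
    unfolding LIMSEQ_iff u(2) by (metis norm_minus_commute order_refl)
qed

instance proj_tensor :: (real_normed_vector, real_normed_vector) banach
proof
  fix Z :: "nat \<Rightarrow> ('a, 'b) proj_tensor"
  assume Z: "Cauchy Z"
  have "\<exists>u. norm (Z n - to_proj_tensor u) < 1 / Suc n" for n
    by (rule to_proj_tensor_dense) simp
  then obtain u where u: "\<And>n. norm (Z n - to_proj_tensor (u n)) < 1 / Suc n" by metis
  have diff: "(\<lambda>n. Z n - to_proj_tensor (u n)) \<longlonglongrightarrow> 0"
    by (rule Lim_null_comparison[OF _ LIMSEQ_inverse_real_of_nat])
      (use u in \<open>auto simp: inverse_eq_divide intro!: always_eventually less_imp_le\<close>)
  have "proj_cauchy u"
    unfolding proj_cauchy_def
  proof (intro allI impI)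
    fix e :: real assume "e > 0"
    then have e: "e / 3 > 0" by simp
    obtain M where M: "\<And>m n. m \<ge> M \<Longrightarrow> n \<ge> M \<Longrightarrow> norm (Z m - Z n) < e / 3"
      using Z e unfolding Cauchy_iff by blast
    obtain N where N: "\<And>n. n \<ge> N \<Longrightarrow> norm (Z n - to_proj_tensor (u n)) < e / 3"
      using diff e unfolding LIMSEQ_iff diff_zero by blast
    have "proj_norm (u m - u n) < e" if "m \<ge> max M N" "n \<ge> max M N" for m n
    proof -
      have "proj_norm (u m - u n) = norm ((Z m - Z n) -
          ((Z m - to_proj_tensor (u m)) - (Z n - to_proj_tensor (u n))))"
        by (simp flip: norm_to_proj_tensor add: to_proj_tensor_diff)
      also have "\<dots> \<le> norm (Z m - Z n) +
          (norm (Z m - to_proj_tensor (u m)) + norm (Z n - to_proj_tensor (u n)))"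
        by (intro order_trans[OF norm_triangle_ineq4] add_left_mono norm_triangle_ineq4)
      also have "\<dots> < e / 3 + (e / 3 + e / 3)"
        using that by (intro add_strict_mono M N) auto
      finally show ?thesis by simp
    qed
    then show "\<exists>N. \<forall>m\<ge>N. \<forall>n\<ge>N. proj_norm (u m - u n) < e" by blast
  qed
  from tendsto_add[OF diff to_proj_tensor_LIMSEQ[OF this]]
  show "convergent Z" by (auto simp: convergent_def)
qed

section \<open>\<open>L\<^sub>1\<close>-preduals\<close>

text \<open>\<open>L\<^sub>1(\<mu>)\<close> consists of the classes of integrable functions modulo almost everywhere equality.\<close>

definition L1 :: "'m measure \<Rightarrow> ('m \<Rightarrow> real) set set"
  where "L1 \<mu> = {f. integrable \<mu> f} //
    {(f, g). integrable \<mu> f \<and> integrable \<mu> g \<and> (AE x in \<mu>. f x = g x)}"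

text \<open>
  The vector space operations and the norm of \<open>L\<^sub>1(\<mu>)\<close> are given by those of representatives.
\<close>

definition L1_isometric_isomorphism ::
    "'m measure \<Rightarrow> ('z::real_normed_vector \<Rightarrow> ('m \<Rightarrow> real) set) \<Rightarrow> bool"
  where "L1_isometric_isomorphism \<mu> \<Phi> \<longleftrightarrow>
    bij_betw \<Phi> UNIV (L1 \<mu>) \<and>
    (\<forall>u v. \<forall>f\<in>\<Phi> u. \<forall>g\<in>\<Phi> v. (\<lambda>x. f x + g x) \<in> \<Phi> (u + v)) \<and>
    (\<forall>c u. \<forall>f\<in>\<Phi> u. (\<lambda>x. c * f x) \<in> \<Phi> (c *\<^sub>R u)) \<and>
    (\<forall>u. \<forall>f\<in>\<Phi> u. norm u = (\<integral>x. \<bar>f x\<bar> \<partial>\<mu>))"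

text \<open>
  The type of points of \<open>\<mu>\<close> is a parameter, as one cannot quantify existentially over types. When
  \<open>L1_predual\<close> is a hypothesis of a theorem, its type variable \<open>'m\<close> is universally quantified on
  the outside, which amounts to assuming that some measure on some type exists.
\<close>

definition L1_predual :: "'m itself \<Rightarrow> 'x::banach itself \<Rightarrow> bool"
  where "L1_predual _ _ \<longleftrightarrow>
    (\<exists>(\<mu> :: 'm measure) (\<Phi> :: ('x \<Rightarrow>\<^sub>L real) \<Rightarrow> ('m \<Rightarrow> real) set).
      L1_isometric_isomorphism \<mu> \<Phi>)"

definition infinite_dimensional :: "'x::real_vector itself \<Rightarrow> bool"
  where "infinite_dimensional _ \<longleftrightarrow> (\<nexists>B :: 'x set. finite B \<and> span B = UNIV)"

section \<open>The diameter two property\<close>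

definition weak_topology :: "'z::real_normed_vector topology"
  where "weak_topology =
    topology_generated_by {blinfun_apply f -` U | (f :: 'z \<Rightarrow>\<^sub>L real) U. open U}"

definition diameter_two_property :: "'z::banach itself \<Rightarrow> bool"
  where "diameter_two_property _ \<longleftrightarrow>
    (\<forall>W :: 'z set. openin (subtopology weak_topology (cball 0 1)) W \<and> W \<noteq> {} \<longrightarrow> diameter W = 2)"

end

theory Submission
  imports Defs
begin

text \<open>
  A weakly open set restricts only finitely many functionals. So it suffices to find, near a
  given point, two points of the unit ball on which these functionals almost agree, although their
  distance is almost \<open>2\<close>.

  Every weak neighbourhood of a point of the ball contains a tensor \<open>u\<close> with norm below but
  close to \<open>1\<close>, because \<open>X\<close> is infinite-dimensional
  (\<open>weak_neighbourhood_almost_unit_tensor\<close>). Write \<open>u\<close> as a sum of tensors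
  \<open>x\<^sub>i \<otimes> y\<^sub>i\<close> with \<open>\<parallel>x\<^sub>1\<parallel> \<parallel>y\<^sub>1\<parallel> + \<dots> + \<parallel>x\<^sub>k\<parallel> \<parallel>y\<^sub>k\<parallel> < 1\<close>, and let \<open>\<phi>\<close> be a
  norming functional for \<open>u\<close>. Only the factors \<open>x\<^sub>i\<close> are modified. A functional on the
  tensor product acts on them through finitely many elements \<open>v\<close> of \<open>X\<^sup>*\<close>, which is
  \<open>L\<^sub>1(\<mu>)\<close>. These are almost constant on the members of a finite disjoint family of sets \<open>A\<close>, and
  since \<open>L\<^sub>1(\<mu>)\<close> is infinite-dimensional there is room for a second disjoint family of copies
  \<open>\<beta> A\<close>. The normalised indicators of all these sets span an \<open>\<ell>\<^sub>1\<close> isometrically, so by Helly's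
  theorem every bounded choice of values on them is taken by an element of \<open>X\<close> of almost the
  same bound. Thus \<open>x\<^sub>i\<close> can be replaced by points that look like \<open>x\<^sub>i\<close> on the sets \<open>A\<close>, and like
  \<open>x\<^sub>i\<close> or \<open>- x\<^sub>i\<close> on their copies
  (\<open>indistinguishable_separated_pairs\<close>). The first property keeps the
  two new tensors in the weak neighbourhood. Their difference looks on the copies like \<open>2 u\<close>; the
  contraction \<open>Q\<close> of \<open>L\<^sub>1(\<mu>)\<close> that averages over the sets \<open>A\<close> and moves the averages to the
  copies turns \<open>\<phi>\<close> into a bilinear form of norm at most \<open>1\<close> which shows that the difference has norm
  almost \<open>2\<close>.
\<close>

section \<open>The Hahn--Banach theorem\<close>

lemma cINF_le_add:
  fixes h :: "'k \<Rightarrow> real"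
  assumes "I \<noteq> {}" "J \<noteq> {}" "bdd_below (h ` K)"
    and "\<And>i j. i \<in> I \<Longrightarrow> j \<in> J \<Longrightarrow> \<exists>k\<in>K. h k \<le> f i + g j"
  shows "(INF k\<in>K. h k) \<le> (INF i\<in>I. f i) + (INF j\<in>J. g j)"
proof -
  have le: "(INF k\<in>K. h k) \<le> f i + g j" if "i \<in> I" "j \<in> J" for i j
    using assms(4)[OF that] cINF_lower[OF assms(3)] by (meson order_trans)
  have "(INF k\<in>K. h k) - f i \<le> (INF j\<in>J. g j)" if "i \<in> I" for i
    by (rule cINF_greatest[OF assms(2)]) (use le[OF that] in \<open>simp add: algebra_simps\<close>)
  then have "(INF k\<in>K. h k) - (INF j\<in>J. g j) \<le> (INF i\<in>I. f i)"
    by (intro cINF_greatest[OF assms(1)]) (simp add: algebra_simps)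
  then show ?thesis by simp
qed

lemma cINF_le_mult:
  fixes h :: "'k \<Rightarrow> real"
  assumes "I \<noteq> {}" "bdd_below (h ` K)" "c > 0"
    and "\<And>i. i \<in> I \<Longrightarrow> \<exists>k\<in>K. h k \<le> c * f i"
  shows "(INF k\<in>K. h k) \<le> c * (INF i\<in>I. f i)"
proof -
  have "(INF k\<in>K. h k) \<le> c * f i" if "i \<in> I" for i
    using assms(4)[OF that] cINF_lower[OF assms(2)] by (meson order_trans)
  then have "(INF k\<in>K. h k) / c \<le> (INF i\<in>I. f i)"
    using assms(3) by (intro cINF_greatest[OF assms(1)]) (simp add: field_simps)
  then show ?thesis using assms(3) by (simp add: field_simps)
qed

text \<open>
  Homogeneity is asked for as an inequality and for positive factors only: the reverse inequality
  and the value at \<open>0\<close> follow.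
\<close>

definition sublinear :: "('a::real_vector \<Rightarrow> real) \<Rightarrow> bool"
  where "sublinear q \<longleftrightarrow> (\<forall>x y. q (x + y) \<le> q x + q y) \<and> (\<forall>c>0. \<forall>x. q (c *\<^sub>R x) \<le> c * q x)"

lemma sublinear_add: "sublinear q \<Longrightarrow> q (x + y) \<le> q x + q y"
  by (simp add: sublinear_def)

lemma sublinear_zero:
  assumes "sublinear q"
  shows "q 0 = 0"
proof -
  have "q 0 \<le> q 0 + q 0" using sublinear_add[OF assms, of 0 0] by simp
  moreover have "q ((1/2) *\<^sub>R 0) \<le> 1/2 * q 0"
    using assms unfolding sublinear_def by (metis half_gt_zero_iff zero_less_one)
  ultimately show ?thesis by simp
qed

lemma sublinear_scaleR:
  assumes "sublinear q" "c \<ge> 0"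
  shows "q (c *\<^sub>R x) = c * q x"
proof (cases "c = 0")
  case False
  then have c: "c > 0" using assms(2) by simp
  have "q (inverse c *\<^sub>R (c *\<^sub>R x)) \<le> inverse c * q (c *\<^sub>R x)"
    using assms(1) c unfolding sublinear_def by (metis inverse_positive_iff_positive)
  then have "c * q x \<le> q (c *\<^sub>R x)" using c by (simp add: field_simps)
  moreover have "q (c *\<^sub>R x) \<le> c * q x" using assms(1) c by (simp add: sublinear_def)
  ultimately show ?thesis by simp
qed (simp add: sublinear_zero[OF assms(1)])

lemma sublinear_minus: "sublinear q \<Longrightarrow> - q (- x) \<le> q x"
  using sublinear_add[of q x "- x"] sublinear_zero[of q] by simp

text \<open>
  The value of \<open>q\<close> at \<open>- a\<close> can be lowered to \<open>- q a\<close> without losing sublinearity. Hence a minimal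
  sublinear functional is odd, and therefore linear.
\<close>

lemma sublinear_lower:
  assumes "sublinear q"
  obtains r where "sublinear r" "\<And>x. r x \<le> q x" "r (- a) \<le> - q a"
proof
  define r where "r x = (INF t\<in>{0..}. q (x + t *\<^sub>R a) - t * q a)" for x
  have bdd: "bdd_below ((\<lambda>t. q (x + t *\<^sub>R a) - t * q a) ` {0..})" for x
  proof (rule bdd_belowI2)
    fix t :: real assume "t \<in> {0..}"
    then have "t * q a = q ((x + t *\<^sub>R a) + (- x))" by (simp add: sublinear_scaleR[OF assms])
    also have "\<dots> \<le> q (x + t *\<^sub>R a) + q (- x)" by (rule sublinear_add[OF assms])
    finally show "- q (- x) \<le> q (x + t *\<^sub>R a) - t * q a" by simp
  qed
  show "sublinear r"
    unfolding sublinear_def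
  proof (intro conjI allI impI)
    fix x y
    show "r (x + y) \<le> r x + r y"
      unfolding r_def
    proof (rule cINF_le_add[OF _ _ bdd])
      fix s t :: real assume "s \<in> {0..}" "t \<in> {0..}"
      moreover have "q (x + y + (s + t) *\<^sub>R a) \<le> q (x + s *\<^sub>R a) + q (y + t *\<^sub>R a)"
        using sublinear_add[OF assms, of "x + s *\<^sub>R a" "y + t *\<^sub>R a"] by (simp add: algebra_simps)
      ultimately show "\<exists>k\<in>{0..}. q (x + y + k *\<^sub>R a) - k * q a
          \<le> q (x + s *\<^sub>R a) - s * q a + (q (y + t *\<^sub>R a) - t * q a)"
        by (intro bexI[of _ "s + t"]) (auto simp: algebra_simps)
    qed auto
  next
    fix c :: real and x assume c: "c > 0"
    show "r (c *\<^sub>R x) \<le> c * r x"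
      unfolding r_def
    proof (rule cINF_le_mult[OF _ bdd c])
      fix t :: real assume "t \<in> {0..}"
      moreover have "q (c *\<^sub>R x + (c * t) *\<^sub>R a) = c * q (x + t *\<^sub>R a)"
        using sublinear_scaleR[OF assms, of c "x + t *\<^sub>R a"] c by (simp add: algebra_simps)
      ultimately show "\<exists>k\<in>{0..}. q (c *\<^sub>R x + k *\<^sub>R a) - k * q a \<le> c * (q (x + t *\<^sub>R a) - t * q a)"
        using c by (intro bexI[of _ "c * t"]) (auto simp: algebra_simps)
    qed auto
  qed
  show "r x \<le> q x" for x
    unfolding r_def using cINF_lower[OF bdd, of 0 x] by simp
  show "r (- a) \<le> - q a"
    unfolding r_def using cINF_lower[OF bdd, of 1 "- a"] by (simp add: sublinear_zero[OF assms])
qed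

lemma sublinear_chain_INF:
  assumes "C \<noteq> {}" "\<And>q. q \<in> C \<Longrightarrow> sublinear q" "\<And>q x. q \<in> C \<Longrightarrow> q x \<le> p x"
    and "\<And>q r. q \<in> C \<Longrightarrow> r \<in> C \<Longrightarrow> (\<forall>x. q x \<le> r x) \<or> (\<forall>x. r x \<le> q x)"
  shows "sublinear (\<lambda>x. INF q\<in>C. q x)" "q \<in> C \<Longrightarrow> (INF q\<in>C. q x) \<le> q x"
proof -
  have bdd: "bdd_below ((\<lambda>q. q x) ` C)" for x
  proof (rule bdd_belowI2)
    fix q assume "q \<in> C"
    then show "- p (- x) \<le> q x"
      using sublinear_minus[OF assms(2), of q x] assms(3)[of q "- x"] by simp
  qed
  show "(INF q\<in>C. q x) \<le> q x" if "q \<in> C"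
    by (rule cINF_lower[OF bdd that])
  show "sublinear (\<lambda>x. INF q\<in>C. q x)"
    unfolding sublinear_def
  proof (intro conjI allI impI)
    fix x y
    show "(INF q\<in>C. q (x + y)) \<le> (INF q\<in>C. q x) + (INF q\<in>C. q y)"
    proof (rule cINF_le_add[OF assms(1) assms(1) bdd])
      fix q r assume qr: "q \<in> C" "r \<in> C"
      show "\<exists>k\<in>C. k (x + y) \<le> q x + r y"
        using assms(4)[OF qr]
      proof
        assume "\<forall>x. q x \<le> r x"
        then show ?thesis
          using sublinear_add[OF assms(2)[OF qr(1)], of x y] qr by (intro bexI[of _ q]) (auto intro: order_trans)
      next
        assume "\<forall>x. r x \<le> q x"
        then have "r (x + y) \<le> q x + r y"
          using sublinear_add[OF assms(2)[OF qr(2)], of x y] by (meson add_right_mono order_trans)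
        then show ?thesis using qr by blast
      qed
    qed
  next
    fix c :: real and x assume "c > 0"
    then show "(INF q\<in>C. q (c *\<^sub>R x)) \<le> c * (INF q\<in>C. q x)"
      using assms(2) by (intro cINF_le_mult[OF assms(1) bdd] bexI) (auto simp: sublinear_def)
  qed
qed

text \<open>
  A minimal sublinear functional below \<open>p\<close> exists by Zorn's lemma. It takes the prescribed value at
  \<open>a\<close> if one starts from a functional whose value at \<open>- a\<close> has already been lowered to \<open>- p a\<close>.
\<close>

theorem Hahn_Banach_sublinear:
  assumes "sublinear p"
  obtains \<phi> where "linear \<phi>" "\<And>x. \<phi> x \<le> p x" "\<phi> a = p a"
proof -
  obtain p' where p': "sublinear p'" "\<And>x. p' x \<le> p x" "p' (- a) \<le> - p a"
    using sublinear_lower[OF assms, of a] by blast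
  define Q where "Q = {q. sublinear q \<and> (\<forall>x. q x \<le> p' x)}"
  define P where "P q r \<longleftrightarrow> (\<forall>x. r x \<le> q x)" for q r :: "'a \<Rightarrow> real"
  have "\<exists>m\<in>Q. \<forall>q\<in>Q. P m q \<longrightarrow> q = m"
  proof (rule predicate_Zorn)
    show "partial_order_on Q (relation_of P Q)"
      unfolding partial_order_on_def preorder_on_def refl_on_def trans_def antisym_def relation_of_def P_def
      by (auto intro: order_trans intro!: ext antisym)
  next
    fix C assume C: "C \<in> Chains (relation_of P Q)"
    show "\<exists>u\<in>Q. \<forall>q\<in>C. P q u"
    proof (cases "C = {}")
      case True
      then show ?thesis using p'(1) by (auto simp: Q_def)
    next
      case False
      have CQ: "C \<subseteq> Q" and tot: "P q r \<or> P r q" if "q \<in> C" "r \<in> C" for q r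
        using C that unfolding Chains_def relation_of_def by auto
      have Cq: "sublinear q" "q x \<le> p' x" if "q \<in> C" for q x
        using CQ that by (auto simp: Q_def)
      have tot': "(\<forall>x. q x \<le> r x) \<or> (\<forall>x. r x \<le> q x)" if "q \<in> C" "r \<in> C" for q r
        using tot[OF that] by (auto simp: P_def)
      have inf_sub: "sublinear (\<lambda>x. INF q\<in>C. q x)"
        by (rule sublinear_chain_INF(1)[where p = p', OF False]) (use Cq tot' in blast)+
      have inf_le: "(INF q\<in>C. q x) \<le> q x" if "q \<in> C" for q x
        by (rule sublinear_chain_INF(2)[where p = p', OF False]) (use Cq tot' that in blast)+
      obtain q0 where q0: "q0 \<in> C" using False by blast
      have "(INF q\<in>C. q x) \<le> p' x" for x
        using inf_le[OF q0] Cq(2)[OF q0] by (meson order_trans)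
      then have "(\<lambda>x. INF q\<in>C. q x) \<in> Q" using inf_sub by (simp add: Q_def)
      then show ?thesis using inf_le unfolding P_def by (intro bexI[of _ "\<lambda>x. INF q\<in>C. q x"] ballI allI)
    qed
  qed
  then obtain m where m: "m \<in> Q" and min: "\<And>q. q \<in> Q \<Longrightarrow> (\<forall>x. q x \<le> m x) \<Longrightarrow> q = m"
    unfolding P_def by blast
  have sub: "sublinear m" and le: "\<And>x. m x \<le> p' x" using m by (auto simp: Q_def)
  have odd: "m (- x) = - m x" for x
  proof -
    obtain r where r: "sublinear r" "\<And>y. r y \<le> m y" "r (- x) \<le> - m x"
      using sublinear_lower[OF sub, of x] by blast
    have "r \<in> Q" using r(1) r(2) le by (auto simp: Q_def intro: order_trans)
    then have "r = m" using min r(2) by blast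
    then show ?thesis using r(3) sublinear_minus[OF sub, of x] by simp
  qed
  have "linear m"
  proof (rule linearI)
    fix x y
    have "m (- x + - y) \<le> m (- x) + m (- y)" by (rule sublinear_add[OF sub])
    then have "m x + m y \<le> m (x + y)" using odd[of "x + y"] by (simp add: odd)
    then show "m (x + y) = m x + m y" using sublinear_add[OF sub, of x y] by simp
  next
    fix c :: real and x
    show "m (c *\<^sub>R x) = c *\<^sub>R m x"
    proof (cases "c \<ge> 0")
      case False
      have "m (c *\<^sub>R x) = m (- ((- c) *\<^sub>R x))" by simp
      also have "\<dots> = - m ((- c) *\<^sub>R x)" by (rule odd)
      also have "m ((- c) *\<^sub>R x) = (- c) * m x" using False by (intro sublinear_scaleR[OF sub]) simp
      finally show ?thesis by simp
    qed (simp add: sublinear_scaleR[OF sub])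
  qed
  moreover have "m x \<le> p x" for x using le p'(2) by (meson order_trans)
  moreover have "m a = p a"
    using le[of "- a"] p'(3) odd[of a] calculation(2)[of a] by simp
  ultimately show thesis using that by blast
qed

corollary Hahn_Banach_norming:
  fixes a :: "'a::real_normed_vector"
  obtains f :: "'a \<Rightarrow>\<^sub>L real" where "norm f \<le> 1" "blinfun_apply f a = norm a"
proof -
  have "sublinear (norm :: 'a \<Rightarrow> real)" by (simp add: sublinear_def norm_triangle_ineq)
  then obtain \<phi> :: "'a \<Rightarrow> real" where \<phi>: "linear \<phi>" "\<And>x. \<phi> x \<le> norm x" "\<phi> a = norm a"
    using Hahn_Banach_sublinear[of norm a] by blast
  have abs: "\<bar>\<phi> x\<bar> \<le> norm x" for x
    using \<phi>(2)[of x] \<phi>(2)[of "- x"] linear_neg[OF \<phi>(1), of x] by simp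
  then have "bounded_linear \<phi>"
    using \<phi>(1) by (intro bounded_linear_intro[where K = 1]) (auto simp: linear_add linear_scale)
  then have app: "blinfun_apply (Blinfun \<phi>) = \<phi>" by (rule bounded_linear_Blinfun_apply)
  show thesis
  proof (rule that[of "Blinfun \<phi>"])
    show "norm (Blinfun \<phi>) \<le> 1" by (rule norm_blinfun_bound) (simp_all add: app abs)
  qed (simp add: app \<phi>(3))
qed

section \<open>Finitely many functionals\<close>

lemma functional_in_span:
  fixes f :: "'i \<Rightarrow> 'a::real_vector \<Rightarrow> real"
  assumes "finite I" "\<And>i. i \<in> I \<Longrightarrow> linear (f i)" "linear \<phi>"
    and "\<And>x. (\<And>i. i \<in> I \<Longrightarrow> f i x = 0) \<Longrightarrow> \<phi> x = 0"
  obtains t where "\<And>x. \<phi> x = (\<Sum>i\<in>I. t i * f i x)"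
proof -
  have "\<exists>t. \<forall>x. \<phi> x = (\<Sum>i\<in>I. t i * f i x)"
    using assms
  proof (induction I arbitrary: \<phi> rule: finite_induct)
    case empty
    then show ?case by simp
  next
    case (insert j I)
    have lin: "linear (f j)" using insert.prems(1) by simp
    obtain c where c: "\<And>x. (\<And>i. i \<in> I \<Longrightarrow> f i x = 0) \<Longrightarrow> \<phi> x - c * f j x = 0"
    proof (cases "\<exists>e. (\<forall>i\<in>I. f i e = 0) \<and> f j e \<noteq> 0")
      case True
      then obtain e where e: "\<And>i. i \<in> I \<Longrightarrow> f i e = 0" "f j e \<noteq> 0" by blast
      show thesis
      proof (rule that[of "\<phi> e / f j e"])
        fix x assume x: "\<And>i. i \<in> I \<Longrightarrow> f i x = 0"
        have "\<phi> (x - (f j x / f j e) *\<^sub>R e) = 0"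
          using insert.prems(1) e x
          by (intro insert.prems(3)) (auto simp: linear_diff linear_scale)
        then show "\<phi> x - \<phi> e / f j e * f j x = 0"
          by (simp add: linear_diff[OF insert.prems(2)] linear_scale[OF insert.prems(2)])
      qed
    next
      case False
      then show thesis using insert.prems(3) by (intro that[of 0]) auto
    qed
    have "linear (\<lambda>x. \<phi> x - c * f j x)"
      using lin insert.prems(2)
      by (intro linearI) (simp_all add: linear_add linear_scale algebra_simps)
    then obtain t where t: "\<And>x. \<phi> x - c * f j x = (\<Sum>i\<in>I. t i * f i x)"
      using insert.IH[of "\<lambda>x. \<phi> x - c * f j x"] insert.prems(1) c by auto
    have "(\<Sum>i\<in>I. (t(j := c)) i * f i x) = (\<Sum>i\<in>I. t i * f i x)" for x
      using insert.hyps(2) by (intro sum.cong) auto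
    then have "\<phi> x = (\<Sum>i\<in>insert j I. (t(j := c)) i * f i x)" for x
      using insert.hyps t[of x] by (simp add: algebra_simps)
    then show ?case by blast
  qed
  then show thesis using that by blast
qed

lemma linear_blinfun_apply: "linear (blinfun_apply f)"
  by (intro linearI) (simp_all add: blinfun.add_right blinfun.scaleR_right)

text \<open>
  Modulo the common kernel of finitely many functionals, the space is spanned by finitely many
  vectors.
\<close>

lemma infinite_dimensional_common_kernel:
  fixes V :: "('a::real_vector \<Rightarrow> real) set"
  assumes "infinite_dimensional TYPE('a)" "finite V" "\<And>v. v \<in> V \<Longrightarrow> linear v"
  obtains x where "x \<noteq> 0" "\<And>v. v \<in> V \<Longrightarrow> v x = 0"
proof -
  have "\<exists>B. finite B \<and> (\<forall>x. \<exists>s\<in>span B. \<forall>v\<in>V. v (x - s) = 0)"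
    using assms(2,3)
  proof (induction V rule: finite_induct)
    case empty
    then show ?case by (auto intro: exI[of _ "{}"])
  next
    case (insert w V)
    have lin: "linear w" "\<And>v. v \<in> V \<Longrightarrow> linear v" using insert.prems by auto
    obtain B where B: "finite B" "\<And>x. \<exists>s\<in>span B. \<forall>v\<in>V. v (x - s) = 0"
      using insert.IH lin by blast
    show ?case
    proof (cases "\<exists>e. (\<forall>v\<in>V. v e = 0) \<and> w e \<noteq> 0")
      case True
      then obtain e where e: "\<And>v. v \<in> V \<Longrightarrow> v e = 0" "w e \<noteq> 0" by blast
      have "\<exists>s\<in>span (insert e B). \<forall>v\<in>insert w V. v (x - s) = 0" for x
      proof -
        obtain s where s: "s \<in> span B" "\<And>v. v \<in> V \<Longrightarrow> v (x - s) = 0" using B(2) by blast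
        define c where "c = w (x - s) / w e"
        have "s + c *\<^sub>R e \<in> span (insert e B)"
          using s(1) by (intro span_add span_scale) (auto intro: span_base span_mono[THEN subsetD, of B])
        moreover have expand: "v (x - (s + c *\<^sub>R e)) = v (x - s) - c * v e" if "linear v" for v
          using that by (simp add: linear_diff linear_add linear_scale)
        moreover have "v (x - (s + c *\<^sub>R e)) = 0" if "v \<in> insert w V" for v
          using expand[of v] that s(2)[of v] e lin by (cases "v = w") (auto simp: c_def)
        ultimately show ?thesis by blast
      qed
      then show ?thesis using B(1) by (intro exI[of _ "insert e B"]) auto
    next
      case False
      then show ?thesis using B by (intro exI[of _ B]) blast
    qed
  qed
  then obtain B where B: "finite B" "\<And>x. \<exists>s\<in>span B. \<forall>v\<in>V. v (x - s) = 0" by blast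
  have "span B \<noteq> UNIV" using assms(1) B(1) unfolding infinite_dimensional_def by blast
  then obtain y where y: "y \<notin> span B" by blast
  obtain s where "s \<in> span B" "\<forall>v\<in>V. v (y - s) = 0" using B(2) by blast
  then show thesis using that[of "y - s"] y by auto
qed

text \<open>
  This is Helly's theorem for a system of functionals that behaves like the unit vectors of
  \<open>\<ell>\<^sub>1\<close>. Solvability of the system without a norm bound is linear algebra. The smallest
  norm of a solution is the distance of any solution \<open>x\<^sub>0\<close> from the common kernel; by Hahn--Banach this
  distance is the value at \<open>x\<^sub>0\<close> of a functional vanishing on the common kernel, that is, of a
  linear combination of the given functionals.
\<close>

lemma Helly_l1:
  fixes f :: "'i \<Rightarrow> 'a::real_normed_vector \<Rightarrow>\<^sub>L real"
  assumes fin: "finite I"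
    and l1: "\<And>t. (\<Sum>i\<in>I. \<bar>t i\<bar>) \<le> norm (\<Sum>i\<in>I. t i *\<^sub>R f i)"
    and c: "\<And>i. i \<in> I \<Longrightarrow> \<bar>c i\<bar> \<le> M" and "M < M'" "0 \<le> M"
  obtains x where "norm x \<le> M'" "\<And>i. i \<in> I \<Longrightarrow> blinfun_apply (f i) x = c i"
proof -
  have "\<exists>e. f i e = 1 \<and> (\<forall>j\<in>I - {i}. f j e = 0)" if i: "i \<in> I" for i
  proof (rule ccontr)
    assume no: "\<not> ?thesis"
    have vanish: "f i x = 0" if "\<And>j. j \<in> I - {i} \<Longrightarrow> f j x = 0" for x
    proof (rule ccontr)
      assume "f i x \<noteq> 0"
      then have "f i (inverse (f i x) *\<^sub>R x) = 1 \<and> (\<forall>j\<in>I - {i}. f j (inverse (f i x) *\<^sub>R x) = 0)"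
        using that by (simp add: blinfun.scaleR_right)
      then show False using no by blast
    qed
    obtain t where t: "\<And>x. f i x = (\<Sum>j\<in>I - {i}. t j * f j x)"
    proof (rule functional_in_span[where f = "\<lambda>j. blinfun_apply (f j)" and \<phi> = "blinfun_apply (f i)"])
      show "finite (I - {i})" using fin by simp
    qed (use linear_blinfun_apply vanish in auto)
    \<comment> \<open>The linear dependence \<open>f i - (\<Sum>j\<in>I - {i}. t j * f j) = 0\<close> contradicts the lower bound.\<close>
    define s where "s j = (if j = i then 1 else - t j)" for j
    have "blinfun_apply (\<Sum>j\<in>I. s j *\<^sub>R f j) x = 0" for x
    proof -
      have "blinfun_apply (\<Sum>j\<in>I. s j *\<^sub>R f j) x = (\<Sum>j\<in>I. s j * f j x)"
        by (simp add: blinfun.sum_left blinfun.scaleR_left)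
      also have "\<dots> = s i * f i x + (\<Sum>j\<in>I - {i}. s j * f j x)"
        using fin i by (rule sum.remove)
      also have "(\<Sum>j\<in>I - {i}. s j * f j x) = - (\<Sum>j\<in>I - {i}. t j * f j x)"
        unfolding sum_negf[symmetric] by (intro sum.cong) (auto simp: s_def)
      finally show ?thesis using t[of x] by (simp add: s_def)
    qed
    then have "(\<Sum>j\<in>I. s j *\<^sub>R f j) = 0" by (intro blinfun_eqI) simp
    then have "(\<Sum>j\<in>I. \<bar>s j\<bar>) \<le> 0" using l1[of s] by simp
    moreover have "\<bar>s i\<bar> \<le> (\<Sum>j\<in>I. \<bar>s j\<bar>)" using fin i by (intro member_le_sum) auto
    ultimately show False by (simp add: s_def)
  qed
  then obtain e where e: "\<And>i. i \<in> I \<Longrightarrow> f i (e i) = 1"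
    "\<And>i j. i \<in> I \<Longrightarrow> j \<in> I \<Longrightarrow> j \<noteq> i \<Longrightarrow> f j (e i) = 0" by (metis insertE insert_Diff)
  define x0 where "x0 = (\<Sum>i\<in>I. c i *\<^sub>R e i)"
  have x0: "f j x0 = c j" if j: "j \<in> I" for j
  proof -
    have "f j x0 = (\<Sum>i\<in>I. if i = j then c j else 0)"
      unfolding x0_def blinfun.sum_right blinfun.scaleR_right using e j by (intro sum.cong) auto
    then show ?thesis using fin j by simp
  qed
  define N where "N = {n. \<forall>i\<in>I. f i n = 0}"
  have N0: "0 \<in> N" by (simp add: N_def)
  define p where "p x = (INF n\<in>N. norm (x + n))" for x
  have bdd: "bdd_below ((\<lambda>n. norm (x + n)) ` N)" for x by (auto intro: bdd_belowI2[of _ 0])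
  have "sublinear p"
    unfolding sublinear_def
  proof (intro conjI allI impI)
    fix x y
    show "p (x + y) \<le> p x + p y"
      unfolding p_def
    proof (rule cINF_le_add[OF _ _ bdd])
      fix m n assume "m \<in> N" "n \<in> N"
      moreover have "norm (x + y + (m + n)) \<le> norm (x + m) + norm (y + n)"
        using norm_triangle_ineq[of "x + m" "y + n"] by (simp add: algebra_simps)
      ultimately show "\<exists>k\<in>N. norm (x + y + k) \<le> norm (x + m) + norm (y + n)"
        by (intro bexI[of _ "m + n"]) (auto simp: N_def blinfun.add_right)
    qed (use N0 in auto)
  next
    fix d :: real and x assume d: "d > 0"
    show "p (d *\<^sub>R x) \<le> d * p x"
      unfolding p_def
    proof (rule cINF_le_mult[OF _ bdd d])
      fix n assume "n \<in> N"
      moreover have "norm (d *\<^sub>R x + d *\<^sub>R n) = d * norm (x + n)"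
        using d by (simp flip: scaleR_add_right)
      ultimately show "\<exists>k\<in>N. norm (d *\<^sub>R x + k) \<le> d * norm (x + n)"
        by (intro bexI[of _ "d *\<^sub>R n"]) (auto simp: N_def blinfun.scaleR_right)
    qed (use N0 in auto)
  qed
  then obtain \<phi> where \<phi>: "linear \<phi>" "\<And>x. \<phi> x \<le> p x" "\<phi> x0 = p x0"
    using Hahn_Banach_sublinear[of p x0] by blast
  have \<phi>_norm: "\<phi> x \<le> norm x" for x
    using \<phi>(2)[of x] cINF_lower[OF bdd N0, of x] by (simp add: p_def)
  have \<phi>_N: "\<phi> n = 0" if "n \<in> N" for n
  proof -
    have "- n \<in> N" using that by (simp add: N_def blinfun.minus_right)
    then have "\<phi> n \<le> 0" "\<phi> (- n) \<le> 0"
      using \<phi>(2)[of n] \<phi>(2)[of "- n"] cINF_lower[OF bdd, of "- n" n] cINF_lower[OF bdd, of n "- n"] that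
      by (auto simp: p_def)
    then show ?thesis using linear_neg[OF \<phi>(1), of n] by simp
  qed
  obtain t where t: "\<And>x. \<phi> x = (\<Sum>i\<in>I. t i * f i x)"
  proof (rule functional_in_span[where f = "\<lambda>i. blinfun_apply (f i)" and \<phi> = \<phi>])
    show "\<phi> x = 0" if "\<And>i. i \<in> I \<Longrightarrow> blinfun_apply (f i) x = 0" for x
      using \<phi>_N that by (simp add: N_def)
  qed (use fin linear_blinfun_apply \<phi>(1) in auto)
  have app: "blinfun_apply (\<Sum>i\<in>I. t i *\<^sub>R f i) x = \<phi> x" for x
    by (simp add: t blinfun.sum_left blinfun.scaleR_left)
  have "norm (\<Sum>i\<in>I. t i *\<^sub>R f i) \<le> 1"
  proof (rule norm_blinfun_bound)
    fix x
    show "norm (blinfun_apply (\<Sum>i\<in>I. t i *\<^sub>R f i) x) \<le> 1 * norm x"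
      using \<phi>_norm[of x] \<phi>_norm[of "- x"] linear_neg[OF \<phi>(1), of x] by (simp add: app)
  qed simp
  then have t1: "(\<Sum>i\<in>I. \<bar>t i\<bar>) \<le> 1" using l1[of t] by simp
  have "p x0 = (\<Sum>i\<in>I. t i * c i)" using \<phi>(3) t[of x0] x0 by simp
  also have "\<dots> \<le> (\<Sum>i\<in>I. \<bar>t i\<bar> * M)"
  proof (rule sum_mono)
    fix i assume "i \<in> I"
    then have "\<bar>t i\<bar> * \<bar>c i\<bar> \<le> \<bar>t i\<bar> * M" by (intro mult_left_mono c) auto
    then show "t i * c i \<le> \<bar>t i\<bar> * M" by (metis abs_ge_self abs_mult order_trans)
  qed
  also have "\<dots> \<le> M"
    using mult_right_mono[OF t1 \<open>0 \<le> M\<close>] by (simp add: sum_distrib_right)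
  finally have "p x0 < M'" using \<open>M < M'\<close> by simp
  then obtain n where n: "n \<in> N" "norm (x0 + n) < M'"
    unfolding p_def using N0 cINF_less_iff[OF _ bdd] by blast
  then show thesis using that[of "x0 + n"] x0 by (auto simp: N_def blinfun.add_right)
qed

section \<open>Integrable functions and disjoint sets of positive measure\<close>

text \<open>
  Being a measurable set of finite positive measure is expressed by \<open>measure \<mu> A > 0\<close>, since
  \<^const>\<open>measure\<close> is \<open>0\<close> on non-measurable sets and on sets of infinite measure.
\<close>

lemma positive_measureD:
  assumes "measure \<mu> A > 0"
  shows "A \<in> sets \<mu>" "emeasure \<mu> A < \<infinity>" "integrable \<mu> (indicator A :: _ \<Rightarrow> real)" "A \<noteq> {}"
proof -
  show A: "A \<in> sets \<mu>" using assms measure_notin_sets by fastforce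
  show "emeasure \<mu> A < \<infinity>"
    using assms by (metis enn2real_top infinity_ennreal_def less_irrefl measure_def top.not_eq_extremum)
  with A show "integrable \<mu> (indicator A :: _ \<Rightarrow> real)" by simp
  show "A \<noteq> {}" using assms by auto
qed

lemma sum_indicator_disjoint:
  fixes t :: "'a set \<Rightarrow> real"
  assumes "finite \<A>" "disjoint \<A>" "A \<in> \<A>" "x \<in> A"
  shows "(\<Sum>B\<in>\<A>. t B * indicator B x) = t A"
proof -
  have "(\<Sum>B\<in>\<A>. t B * indicator B x) = (\<Sum>B\<in>\<A>. if B = A then t A else 0)"
    using assms unfolding disjoint_def by (intro sum.cong) (auto simp: indicator_def)
  then show ?thesis using assms by simp
qed

lemma sum_abs_integral_disjoint_le:
  fixes f :: "'m \<Rightarrow> real"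
  assumes "finite \<A>" "disjoint \<A>" "\<And>A. A \<in> \<A> \<Longrightarrow> A \<in> sets \<mu>" "integrable \<mu> f"
  shows "(\<Sum>A\<in>\<A>. \<bar>\<integral>x. f x * indicator A x \<partial>\<mu>\<bar>) \<le> (\<integral>x. \<bar>f x\<bar> \<partial>\<mu>)"
proof -
  have int: "integrable \<mu> (\<lambda>x. \<bar>f x\<bar> * indicator A x)" if "A \<in> \<A>" for A
    using assms(3)[OF that] assms(4) by (intro integrable_real_mult_indicator) auto
  have "(\<Sum>A\<in>\<A>. \<bar>\<integral>x. f x * indicator A x \<partial>\<mu>\<bar>) \<le> (\<Sum>A\<in>\<A>. \<integral>x. \<bar>f x\<bar> * indicator A x \<partial>\<mu>)"
    using integral_abs_bound[of \<mu> "\<lambda>x. f x * indicator A x" for A]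
    by (intro sum_mono) (simp add: abs_mult)
  also have "\<dots> = (\<integral>x. (\<Sum>A\<in>\<A>. \<bar>f x\<bar> * indicator A x) \<partial>\<mu>)"
    by (rule Bochner_Integration.integral_sum[symmetric]) (rule int)
  also have "\<dots> \<le> (\<integral>x. \<bar>f x\<bar> \<partial>\<mu>)"
  proof (rule integral_mono)
    fix x
    show "(\<Sum>A\<in>\<A>. \<bar>f x\<bar> * indicator A x) \<le> \<bar>f x\<bar>"
    proof (cases "x \<in> \<Union>\<A>")
      case True
      then show ?thesis using sum_indicator_disjoint[OF assms(1,2)] by auto
    next
      case False
      then have "(\<Sum>A\<in>\<A>. \<bar>f x\<bar> * indicator A x) = 0" by (intro sum.neutral) auto
      then show ?thesis by simp
    qed
  qed (use int assms(4) in auto)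
  finally show ?thesis .
qed

lemma integrable_approx_simple:
  fixes f :: "'m \<Rightarrow> real"
  assumes "integrable \<mu> f" "e > 0"
  obtains s where "Bochner_Integration.simple_bochner_integrable \<mu> s" "(\<integral>x. \<bar>f x - s x\<bar> \<partial>\<mu>) < e"
proof -
  obtain s where s: "\<And>i. Bochner_Integration.simple_bochner_integrable \<mu> (s i)"
    and lim: "(\<lambda>i. \<integral>\<^sup>+x. norm (f x - s i x) \<partial>\<mu>) \<longlonglongrightarrow> 0"
    using assms(1) unfolding integrable.simps has_bochner_integral.simps by blast
  have "\<forall>\<^sub>F i in sequentially. (\<integral>\<^sup>+x. norm (f x - s i x) \<partial>\<mu>) < ennreal e"
    using lim assms(2) by (intro order_tendstoD(2)) (auto simp flip: ennreal_0 simp: ennreal_less_iff)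
  then obtain i where i: "(\<integral>\<^sup>+x. norm (f x - s i x) \<partial>\<mu>) < ennreal e"
    by (auto simp: eventually_sequentially)
  have "integrable \<mu> (s i)"
    using has_bochner_integral_simple_bochner_integrable[OF s] by (auto simp: integrable.simps)
  then have "(\<integral>\<^sup>+x. norm (f x - s i x) \<partial>\<mu>) = ennreal (\<integral>x. \<bar>f x - s i x\<bar> \<partial>\<mu>)"
    using assms(1) by (subst nn_integral_eq_integral) auto
  then have "(\<integral>x. \<bar>f x - s i x\<bar> \<partial>\<mu>) < e"
    using i assms(2) by (simp add: ennreal_less_iff)
  then show thesis using that s by blast
qed

text \<open>
  The sets are the joint level sets of simple functions approximating the given functions.
\<close>

lemma finite_family_approx_disjoint:
  fixes H :: "('m \<Rightarrow> real) set"
  assumes "finite H" "\<And>h. h \<in> H \<Longrightarrow> integrable \<mu> h" "e > 0"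
  obtains \<A> c where "finite \<A>" "disjoint \<A>" "\<And>A. A \<in> \<A> \<Longrightarrow> measure \<mu> A > 0"
    "\<And>h. h \<in> H \<Longrightarrow> (\<integral>x. \<bar>h x - (\<Sum>A\<in>\<A>. c h A * indicator A x)\<bar> \<partial>\<mu>) < e"
proof -
  have "\<forall>h\<in>H. \<exists>s. Bochner_Integration.simple_bochner_integrable \<mu> s \<and> (\<integral>x. \<bar>h x - s x\<bar> \<partial>\<mu>) < e"
    using integrable_approx_simple[OF assms(2) assms(3)] by metis
  then obtain s where s: "\<And>h. h \<in> H \<Longrightarrow> Bochner_Integration.simple_bochner_integrable \<mu> (s h)"
    and s_approx: "\<And>h. h \<in> H \<Longrightarrow> (\<integral>x. \<bar>h x - s h x\<bar> \<partial>\<mu>) < e" by metis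
  have sf: "simple_function \<mu> (s h)" and supp: "emeasure \<mu> {x \<in> space \<mu>. s h x \<noteq> 0} \<noteq> \<infinity>"
    if "h \<in> H" for h
    using s[OF that] by (auto simp: Bochner_Integration.simple_bochner_integrable.simps)
  have s_int: "integrable \<mu> (s h)" if "h \<in> H" for h
    using has_bochner_integral_simple_bochner_integrable[OF s[OF that]] by (auto simp: integrable.simps)
  define T where "T = (\<Pi>\<^sub>E h\<in>H. s h ` space \<mu>)"
  define L where "L \<tau> = {x \<in> space \<mu>. \<forall>h\<in>H. s h x = \<tau> h}" for \<tau>
  define \<A> where "\<A> = {A \<in> L ` T. measure \<mu> A > 0}"
  define c where "c h A = s h (SOME x. x \<in> A)" for h A
  have "finite T" unfolding T_def using sf assms(1) by (intro finite_PiE) (auto simp: simple_function_def)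
  then have fin: "finite \<A>" unfolding \<A>_def by simp
  have pos: "\<And>A. A \<in> \<A> \<Longrightarrow> measure \<mu> A > 0" by (simp add: \<A>_def)
  have L_sets: "L \<tau> \<in> sets \<mu>" for \<tau>
  proof -
    have "{x \<in> space \<mu>. s h x = \<tau> h} \<in> sets \<mu>" if "h \<in> H" for h
      using simple_functionD(2)[OF sf[OF that], of "{\<tau> h}"] by (simp add: vimage_def Int_def conj_commute)
    then show ?thesis unfolding L_def using assms(1) by (intro sets.sets_Collect_finite_All) auto
  qed
  have L_inj: "\<tau> = \<sigma>" if "\<tau> \<in> T" "\<sigma> \<in> T" "x \<in> L \<tau>" "x \<in> L \<sigma>" for \<tau> \<sigma> x
    using that unfolding T_def L_def by (intro PiE_ext) auto
  have disj: "disjoint \<A>" unfolding disjoint_def \<A>_def using L_inj by fast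
  have "AE x in \<mu>. x \<notin> L \<tau>" if "emeasure \<mu> (L \<tau>) = 0" for \<tau>
    using that L_sets by (intro AE_not_in) auto
  then have "AE x in \<mu>. \<forall>\<tau>\<in>T. emeasure \<mu> (L \<tau>) = 0 \<longrightarrow> x \<notin> L \<tau>"
    using \<open>finite T\<close> by (intro AE_finite_allI) auto
  then have ae: "AE x in \<mu>. \<forall>h\<in>H. s h x = (\<Sum>A\<in>\<A>. c h A * indicator A x)"
  proof (rule AE_mp, intro AE_I2 impI ballI)
    fix x h assume x: "x \<in> space \<mu>" "\<forall>\<tau>\<in>T. emeasure \<mu> (L \<tau>) = 0 \<longrightarrow> x \<notin> L \<tau>" and h: "h \<in> H"
    define \<tau> where "\<tau> = (\<lambda>h\<in>H. s h x)"
    have \<tau>: "\<tau> \<in> T" "x \<in> L \<tau>" using x(1) by (auto simp: \<tau>_def T_def L_def)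
    show "s h x = (\<Sum>A\<in>\<A>. c h A * indicator A x)"
    proof (cases "measure \<mu> (L \<tau>) > 0")
      case True
      then have "L \<tau> \<in> \<A>" using \<tau> by (simp add: \<A>_def)
      then have "(\<Sum>A\<in>\<A>. c h A * indicator A x) = c h (L \<tau>)"
        using sum_indicator_disjoint[OF fin disj _ \<tau>(2)] by simp
      moreover have "(SOME y. y \<in> L \<tau>) \<in> L \<tau>" using \<tau>(2) by (rule someI)
      then have "c h (L \<tau>) = s h x" using h by (simp add: c_def L_def \<tau>_def)
      ultimately show ?thesis by simp
    next
      case False
      have "x \<notin> A" if "A \<in> \<A>" for A
        using that False \<tau> L_inj unfolding \<A>_def by blast
      then have "(\<Sum>A\<in>\<A>. c h A * indicator A x) = 0" by (intro sum.neutral) auto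
      moreover have "s h x = 0"
      proof (rule ccontr)
        \<comment> \<open>Then the level set of \<open>x\<close> has finite measure, so being outside the family makes it a null set.\<close>
        assume "s h x \<noteq> 0"
        then have "L \<tau> \<subseteq> {x \<in> space \<mu>. s h x \<noteq> 0}" using h by (auto simp: L_def \<tau>_def)
        moreover have "{x \<in> space \<mu>. s h x \<noteq> 0} \<in> sets \<mu>"
          using borel_measurable_simple_function[OF sf[OF h]] by measurable
        ultimately have "emeasure \<mu> (L \<tau>) \<le> emeasure \<mu> {x \<in> space \<mu>. s h x \<noteq> 0}"
          by (rule emeasure_mono)
        then have "emeasure \<mu> (L \<tau>) \<noteq> \<infinity>" using supp[OF h] by (auto simp: top_unique)
        then have "emeasure \<mu> (L \<tau>) = 0"
          using False by (simp add: emeasure_eq_ennreal_measure not_less measure_le_0_iff)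
        then show False using x(2) \<tau> by blast
      qed
      ultimately show ?thesis by simp
    qed
  qed
  have "(\<integral>x. \<bar>h x - (\<Sum>A\<in>\<A>. c h A * indicator A x)\<bar> \<partial>\<mu>) < e" if h: "h \<in> H" for h
  proof -
    have "(\<integral>x. \<bar>h x - (\<Sum>A\<in>\<A>. c h A * indicator A x)\<bar> \<partial>\<mu>) = (\<integral>x. \<bar>h x - s h x\<bar> \<partial>\<mu>)"
    proof (rule integral_cong_AE)
      show "AE x in \<mu>. \<bar>h x - (\<Sum>A\<in>\<A>. c h A * indicator A x)\<bar> = \<bar>h x - s h x\<bar>"
        using ae by (rule AE_mp) (use h in auto)
      show "(\<lambda>x. \<bar>h x - s h x\<bar>) \<in> borel_measurable \<mu>"
        using borel_measurable_integrable[OF assms(2)[OF h]] borel_measurable_integrable[OF s_int[OF h]]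
        by measurable
      have [measurable]: "A \<in> sets \<mu>" if "A \<in> \<A>" for A using positive_measureD(1)[OF pos[OF that]] .
      show "(\<lambda>x. \<bar>h x - (\<Sum>A\<in>\<A>. c h A * indicator A x)\<bar>) \<in> borel_measurable \<mu>"
        using borel_measurable_integrable[OF assms(2)[OF h]] by measurable
    qed
    then show ?thesis using s_approx[OF h] by simp
  qed
  then show thesis using that fin disj pos by blast
qed

section \<open>The dual of an \<open>L\<^sub>1\<close>-predual\<close>

text \<open>
  The isometry onto \<open>L\<^sub>1(\<mu>)\<close>, read backwards and on representatives, so that functions can be used
  in place of classes.
\<close>

locale L1_dual =
  fixes \<mu> :: "'m measure" and \<Psi> :: "('m \<Rightarrow> real) \<Rightarrow> ('x::real_normed_vector \<Rightarrow>\<^sub>L real)"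
  assumes \<Psi>_add: "integrable \<mu> f \<Longrightarrow> integrable \<mu> g \<Longrightarrow> \<Psi> (\<lambda>x. f x + g x) = \<Psi> f + \<Psi> g"
    and \<Psi>_scaleR: "integrable \<mu> f \<Longrightarrow> \<Psi> (\<lambda>x. c * f x) = c *\<^sub>R \<Psi> f"
    and norm_\<Psi>: "integrable \<mu> f \<Longrightarrow> norm (\<Psi> f) = (\<integral>x. \<bar>f x\<bar> \<partial>\<mu>)"
    and \<Psi>_surj: "\<exists>f. integrable \<mu> f \<and> \<Psi> f = u"

lemma L1_predual_imp_L1_dual:
  assumes "L1_predual TYPE('m) TYPE('x::banach)"
  obtains \<mu> :: "'m measure" and \<Psi> :: "('m \<Rightarrow> real) \<Rightarrow> ('x::banach \<Rightarrow>\<^sub>L real)" where "L1_dual \<mu> \<Psi>"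
proof -
  obtain \<mu> :: "'m measure" and \<Phi> :: "('x::banach \<Rightarrow>\<^sub>L real) \<Rightarrow> ('m \<Rightarrow> real) set"
    where iso: "L1_isometric_isomorphism \<mu> \<Phi>"
    using assms unfolding L1_predual_def by blast
  define R where "R = {(f, g). integrable \<mu> f \<and> integrable \<mu> g \<and> (AE x in \<mu>. f x = (g x :: real))}"
  have equiv: "equiv {f. integrable \<mu> f} R"
  proof (rule equivI)
    show "trans R"
    proof (rule transI)
      fix f g h assume fgh: "(f, g) \<in> R" "(g, h) \<in> R"
      then have "AE x in \<mu>. f x = g x" "AE x in \<mu>. g x = h x" by (auto simp: R_def)
      then have "AE x in \<mu>. f x = h x" by eventually_elim simp
      then show "(f, h) \<in> R" using fgh by (auto simp: R_def)
    qed
  qed (auto simp: R_def refl_on_def sym_def)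
  have bij: "bij_betw \<Phi> UNIV ({f. integrable \<mu> f} // R)"
    and add: "\<And>u v f g. f \<in> \<Phi> u \<Longrightarrow> g \<in> \<Phi> v \<Longrightarrow> (\<lambda>x. f x + g x) \<in> \<Phi> (u + v)"
    and scale: "\<And>c u f. f \<in> \<Phi> u \<Longrightarrow> (\<lambda>x. c * f x) \<in> \<Phi> (c *\<^sub>R u)"
    and norm: "\<And>u f. f \<in> \<Phi> u \<Longrightarrow> norm u = (\<integral>x. \<bar>f x\<bar> \<partial>\<mu>)"
    using iso unfolding L1_isometric_isomorphism_def L1_def R_def by auto
  have in_quot: "\<Phi> u \<in> {f. integrable \<mu> f} // R" for u using bij by (auto simp: bij_betw_def)
  have unique: "u = v" if "f \<in> \<Phi> u" "f \<in> \<Phi> v" for f u v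
  proof -
    have "\<Phi> u = \<Phi> v" using quotient_disj[OF equiv in_quot in_quot, of u v] that by blast
    then show ?thesis using bij by (auto simp: bij_betw_def dest: injD)
  qed
  define \<Psi> where "\<Psi> f = (SOME u. f \<in> \<Phi> u)" for f
  have \<Psi>: "f \<in> \<Phi> (\<Psi> f)" if "integrable \<mu> f" for f
  proof -
    have "R `` {f} \<in> range \<Phi>"
      using bij that by (auto simp: bij_betw_def intro: quotientI)
    moreover have "f \<in> R `` {f}" using that by (simp add: R_def)
    ultimately have "\<exists>u. f \<in> \<Phi> u" by (metis imageE)
    then show ?thesis unfolding \<Psi>_def by (rule someI_ex)
  qed
  have "L1_dual \<mu> \<Psi>"
  proof
    fix f g :: "'m \<Rightarrow> real" assume "integrable \<mu> f" "integrable \<mu> g"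
    then show "\<Psi> (\<lambda>x. f x + g x) = \<Psi> f + \<Psi> g"
      using unique[OF \<Psi> add[OF \<Psi> \<Psi>]] by simp
  next
    fix f :: "'m \<Rightarrow> real" and c assume "integrable \<mu> f"
    then show "\<Psi> (\<lambda>x. c * f x) = c *\<^sub>R \<Psi> f"
      using unique[OF \<Psi> scale[OF \<Psi>]] by simp
  next
    fix f :: "'m \<Rightarrow> real" assume "integrable \<mu> f"
    then show "norm (\<Psi> f) = (\<integral>x. \<bar>f x\<bar> \<partial>\<mu>)" using norm \<Psi> by blast
  next
    fix u
    obtain f where "f \<in> \<Phi> u" using in_quotient_imp_non_empty[OF equiv in_quot] by blast
    moreover have "integrable \<mu> f"
      using in_quotient_imp_subset[OF equiv in_quot] \<open>f \<in> \<Phi> u\<close> by blast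
    ultimately show "\<exists>f. integrable \<mu> f \<and> \<Psi> f = u" using \<Psi> unique by blast
  qed
  then show thesis by (rule that)
qed

context L1_dual
begin

lemma \<Psi>_diff:
  assumes "integrable \<mu> f" "integrable \<mu> g"
  shows "\<Psi> (\<lambda>x. f x - g x) = \<Psi> f - \<Psi> g"
  using \<Psi>_add[OF assms(1), of "\<lambda>x. (-1) * g x"] \<Psi>_scaleR[OF assms(2), of "-1"] assms by simp

lemma \<Psi>_zero [simp]: "\<Psi> (\<lambda>x. 0) = 0"
  using \<Psi>_scaleR[of "\<lambda>x. 0" 0] by simp

lemma \<Psi>_sum:
  assumes "\<And>i. i \<in> I \<Longrightarrow> integrable \<mu> (f i)"
  shows "\<Psi> (\<lambda>x. \<Sum>i\<in>I. f i x) = (\<Sum>i\<in>I. \<Psi> (f i))"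
  using assms by (induction I rule: infinite_finite_induct) (auto simp: \<Psi>_add)

definition unit :: "'m set \<Rightarrow> ('x \<Rightarrow>\<^sub>L real)"
  where "unit A = (1 / measure \<mu> A) *\<^sub>R \<Psi> (indicator A)"

lemma \<Psi>_indicator: "measure \<mu> A > 0 \<Longrightarrow> \<Psi> (indicator A) = measure \<mu> A *\<^sub>R unit A"
  by (simp add: unit_def)

lemma \<Psi>_simple:
  assumes "\<And>A. A \<in> \<A> \<Longrightarrow> measure \<mu> A > 0"
  shows "\<Psi> (\<lambda>x. \<Sum>A\<in>\<A>. c A * indicator A x) = (\<Sum>A\<in>\<A>. (c A * measure \<mu> A) *\<^sub>R unit A)"
proof -
  have int: "integrable \<mu> (indicator A :: _ \<Rightarrow> real)" if "A \<in> \<A>" for A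
    using positive_measureD(3)[OF assms[OF that]] .
  then have "\<Psi> (\<lambda>x. \<Sum>A\<in>\<A>. c A * indicator A x) = (\<Sum>A\<in>\<A>. \<Psi> (\<lambda>x. c A * indicator A x))"
    by (intro \<Psi>_sum) auto
  also have "\<dots> = (\<Sum>A\<in>\<A>. (c A * measure \<mu> A) *\<^sub>R unit A)"
    using int assms by (intro sum.cong) (simp_all add: \<Psi>_scaleR \<Psi>_indicator)
  finally show ?thesis .
qed

lemma norm_sum_unit:
  assumes "finite \<A>" "disjoint \<A>" and pos: "\<And>A. A \<in> \<A> \<Longrightarrow> measure \<mu> A > 0"
  shows "norm (\<Sum>A\<in>\<A>. t A *\<^sub>R unit A) = (\<Sum>A\<in>\<A>. \<bar>t A\<bar>)"
proof -
  define c where "c A = t A / measure \<mu> A" for A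
  have c: "t A = c A * measure \<mu> A" if "A \<in> \<A>" for A using pos[OF that] by (simp add: c_def)
  have int: "integrable \<mu> (indicator A :: _ \<Rightarrow> real)" if "A \<in> \<A>" for A
    using positive_measureD(3)[OF pos[OF that]] .
  have "(\<Sum>A\<in>\<A>. t A *\<^sub>R unit A) = \<Psi> (\<lambda>x. \<Sum>A\<in>\<A>. c A * indicator A x)"
    using pos c by (simp add: \<Psi>_simple)
  also have "norm \<dots> = (\<integral>x. \<bar>\<Sum>A\<in>\<A>. c A * indicator A x\<bar> \<partial>\<mu>)"
    using int by (intro norm_\<Psi>) auto
  also have "\<dots> = (\<integral>x. (\<Sum>A\<in>\<A>. \<bar>c A\<bar> * indicator A x) \<partial>\<mu>)"
  proof (rule Bochner_Integration.integral_cong[OF refl])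
    fix x
    show "\<bar>\<Sum>A\<in>\<A>. c A * indicator A x\<bar> = (\<Sum>A\<in>\<A>. \<bar>c A\<bar> * indicator A x)"
    proof (cases "x \<in> \<Union>\<A>")
      case True
      then show ?thesis by (auto simp: sum_indicator_disjoint[OF assms(1,2)])
    next
      case False
      then have zero: "(\<Sum>A\<in>\<A>. d A * indicator A x) = 0" for d :: "'m set \<Rightarrow> real"
        by (intro sum.neutral) auto
      show ?thesis by (simp only: zero abs_zero)
    qed
  qed
  also have "\<dots> = (\<Sum>A\<in>\<A>. \<bar>c A\<bar> * measure \<mu> A)"
    using int positive_measureD(1)[OF pos] sets.sets_into_space
    by (subst Bochner_Integration.integral_sum) (auto intro!: sum.cong simp: Int_absorb2)
  also have "\<dots> = (\<Sum>A\<in>\<A>. \<bar>t A\<bar>)"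
    using c by (intro sum.cong) (simp_all add: abs_mult)
  finally show ?thesis .
qed

lemma norm_unit: "measure \<mu> A > 0 \<Longrightarrow> norm (unit A) = 1"
  using norm_sum_unit[of "{A}" "\<lambda>_. 1"] by simp

lemma abs_unit_le: "measure \<mu> A > 0 \<Longrightarrow> \<bar>blinfun_apply (unit A) x\<bar> \<le> norm x"
  using norm_blinfun[of "unit A" x] norm_unit by simp

lemma \<Psi>_indicator_nonzero:
  assumes "blinfun_apply (\<Psi> (indicator A)) x \<noteq> 0" "A \<in> sets \<mu>" "emeasure \<mu> A < \<infinity>"
  shows "measure \<mu> A > 0"
proof -
  have "norm (\<Psi> (indicator A)) = (\<integral>x. indicator A x \<partial>\<mu>)"
    using assms(2,3) by (subst norm_\<Psi>) auto
  also have "\<dots> = measure \<mu> A" using sets.sets_into_space[OF assms(2)] by (simp add: Int_absorb2)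
  finally have "measure \<mu> A \<noteq> 0" using assms(1) by auto
  then show ?thesis by (simp add: zero_less_measure_iff)
qed

text \<open>
  Given a disjoint family, take \<open>x \<noteq> 0\<close> annihilated by the normalised indicators of its members.
  Since simple functions are dense, some set \<open>B\<close> of positive measure has an indicator that does not
  annihilate \<open>x\<close>, and hence so does one of the pieces into which the family cuts \<open>B\<close>. Either this
  piece lies outside the family, or it splits a member into two parts of positive measure.
\<close>

lemma arbitrarily_many_disjoint_positive:
  assumes "infinite_dimensional TYPE('x)"
  obtains \<C> where "finite \<C>" "card \<C> = n" "disjoint \<C>" "\<And>C. C \<in> \<C> \<Longrightarrow> measure \<mu> C > 0"
proof -
  have "\<exists>\<C>. finite \<C> \<and> card \<C> = n \<and> disjoint \<C> \<and> (\<forall>C\<in>\<C>. measure \<mu> C > 0)"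
  proof (induction n)
    case 0
    show ?case by (intro exI[of _ "{}"]) simp
  next
    case (Suc n)
    then obtain \<C> where \<C>: "finite \<C>" "card \<C> = n" "disjoint \<C>"
      and pos: "\<And>C. C \<in> \<C> \<Longrightarrow> measure \<mu> C > 0" by blast
    obtain x where x: "x \<noteq> 0" and kill: "\<And>C. C \<in> \<C> \<Longrightarrow> unit C x = 0"
    proof (rule infinite_dimensional_common_kernel[OF assms])
      show "finite ((\<lambda>C. blinfun_apply (unit C)) ` \<C>)" using \<C>(1) by simp
      show "linear v" if "v \<in> (\<lambda>C. blinfun_apply (unit C)) ` \<C>" for v
        using that linear_blinfun_apply by blast
    qed blast
    have killC: "\<Psi> (indicator C) x = 0" if "C \<in> \<C>" for C
      using kill[OF that] \<Psi>_indicator[OF pos[OF that]] by (simp add: blinfun.scaleR_left)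
    obtain u where u: "blinfun_apply u x = norm x" using Hahn_Banach_norming[of x] by blast
    obtain f where f: "integrable \<mu> f" "\<Psi> f = u" using \<Psi>_surj by blast
    have "finite {f}" "\<And>h. h \<in> {f} \<Longrightarrow> integrable \<mu> h" "(1::real) > 0" using f(1) by auto
    then obtain \<A> c where \<A>: "finite \<A>" "disjoint \<A>" "\<And>A. A \<in> \<A> \<Longrightarrow> measure \<mu> A > 0"
      and approx: "\<And>h. h \<in> {f} \<Longrightarrow> (\<integral>y. \<bar>h y - (\<Sum>A\<in>\<A>. c h A * indicator A y)\<bar> \<partial>\<mu>) < 1"
      by (rule finite_family_approx_disjoint) (assumption | rule that | blast)+
    define g where "g y = (\<Sum>A\<in>\<A>. c f A * indicator A y)" for y
    have g_int: "integrable \<mu> g"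
      unfolding g_def using positive_measureD(3)[OF \<A>(3)] by auto
    have "norm (u - \<Psi> g) = (\<integral>y. \<bar>f y - g y\<bar> \<partial>\<mu>)"
      using norm_\<Psi>[of "\<lambda>y. f y - g y"] \<Psi>_diff[OF f(1) g_int] f g_int by simp
    also have "\<dots> < 1" unfolding g_def by (rule approx) simp
    finally have close: "norm (u - \<Psi> g) < 1" .
    have "\<bar>blinfun_apply (u - \<Psi> g) x\<bar> < norm x"
      using norm_blinfun[of "u - \<Psi> g" x] x close
      by (smt (verit) mult_less_cancel_right2 real_norm_def zero_less_norm_iff)
    then have "\<Psi> g x \<noteq> 0" using u by (auto simp: blinfun.diff_left)
    moreover have "\<Psi> g x = (\<Sum>A\<in>\<A>. (c f A * measure \<mu> A) * unit A x)"
      unfolding g_def using \<A>(3) by (subst \<Psi>_simple) (auto simp: blinfun.sum_left blinfun.scaleR_left)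
    moreover have "(\<Sum>B\<in>\<A>. (c f B * measure \<mu> B) * unit B x) = 0" if "\<forall>B\<in>\<A>. unit B x = 0"
      using that by (intro sum.neutral) simp
    ultimately have "\<not> (\<forall>B\<in>\<A>. unit B x = 0)" by linarith
    then obtain B where B: "B \<in> \<A>" "unit B x \<noteq> 0" by blast
    have B_pos: "measure \<mu> B > 0" using \<A>(3) B(1) .
    note B_meas = positive_measureD[OF B_pos]
    have C_sets: "C \<in> sets \<mu>" if "C \<in> \<C>" for C using positive_measureD(1)[OF pos[OF that]] .
    have B_nz: "\<Psi> (indicator B) x \<noteq> 0"
      using B(2) B_pos \<Psi>_indicator[OF B_pos] by (simp add: blinfun.scaleR_left)
    have sub_fin: "emeasure \<mu> P < \<infinity>" if "P \<subseteq> B" for P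
      using emeasure_mono[OF that B_meas(1)] B_meas(2) by (rule le_less_trans)
    have D_sets: "B - \<Union>\<C> \<in> sets \<mu>" using B_meas(1) C_sets \<C>(1) by auto
    have ind_int: "integrable \<mu> (indicator P :: _ \<Rightarrow> real)" if "P \<subseteq> B" "P \<in> sets \<mu>" for P
      using sub_fin[OF that(1)] that(2) by simp
    have split: "(indicator B :: _ \<Rightarrow> real)
        = (\<lambda>y. indicator (B - \<Union>\<C>) y + (\<Sum>C\<in>\<C>. indicator (B \<inter> C) y))"
    proof
      fix y
      show "(indicator B y :: real) = indicator (B - \<Union>\<C>) y + (\<Sum>C\<in>\<C>. indicator (B \<inter> C) y)"
      proof (cases "y \<in> \<Union>\<C>")
        case True
        then show ?thesis
          using sum_indicator_disjoint[OF \<C>(1,3), of _ y "\<lambda>_. indicator B y"]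
          by (auto simp: indicator_inter_arith)
      next
        case False
        then have "(\<Sum>C\<in>\<C>. indicator (B \<inter> C) y :: real) = 0" by (intro sum.neutral) auto
        then show ?thesis using False by (simp add: indicator_def)
      qed
    qed
    have "\<Psi> (indicator B) = \<Psi> (indicator (B - \<Union>\<C>)) + (\<Sum>C\<in>\<C>. \<Psi> (indicator (B \<inter> C)))"
      unfolding split using ind_int D_sets C_sets B_meas(1)
      by (subst \<Psi>_add) (auto simp: \<Psi>_sum)
    then have "\<Psi> (indicator (B - \<Union>\<C>)) x + (\<Sum>C\<in>\<C>. \<Psi> (indicator (B \<inter> C)) x) \<noteq> 0"
      using B_nz by (simp add: blinfun.add_left blinfun.sum_left)
    moreover have "(\<Sum>C\<in>\<C>. \<Psi> (indicator (B \<inter> C)) x) = 0"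
      if "\<forall>C\<in>\<C>. \<Psi> (indicator (B \<inter> C)) x = 0"
      using that by (rule sum.neutral)
    ultimately consider "\<Psi> (indicator (B - \<Union>\<C>)) x \<noteq> 0"
      | "\<exists>C\<in>\<C>. \<Psi> (indicator (B \<inter> C)) x \<noteq> 0"
      by fastforce
    then show ?case
    proof cases
      case 1
      then have P: "measure \<mu> (B - \<Union>\<C>) > 0"
        using \<Psi>_indicator_nonzero D_sets sub_fin by blast
      then have "B - \<Union>\<C> \<noteq> {}" by (rule positive_measureD)
      then have "B - \<Union>\<C> \<notin> \<C>" by blast
      then show ?thesis using \<C> pos P
        by (intro exI[of _ "insert (B - \<Union>\<C>) \<C>"]) (auto simp: disjoint_def)
    next
      case 2
      then obtain C where C: "C \<in> \<C>" "\<Psi> (indicator (B \<inter> C)) x \<noteq> 0" by blast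
      note C_meas = positive_measureD[OF pos[OF C(1)]]
      have BC_sets: "B \<inter> C \<in> sets \<mu>" "C - B \<in> sets \<mu>" using B_meas(1) C_meas(1) by auto
      have CB_fin: "emeasure \<mu> (C - B) < \<infinity>"
        using emeasure_mono[of "C - B" C] C_meas(1,2) by (meson Diff_subset le_less_trans)
      have BC_pos: "measure \<mu> (B \<inter> C) > 0"
        using \<Psi>_indicator_nonzero[OF C(2) BC_sets(1)] sub_fin by simp
      have "(indicator C :: _ \<Rightarrow> real) = (\<lambda>y. indicator (B \<inter> C) y + indicator (C - B) y)"
        by (auto simp: indicator_def)
      then have "\<Psi> (indicator C) = \<Psi> (indicator (B \<inter> C)) + \<Psi> (indicator (C - B))"
        using \<Psi>_add[of "indicator (B \<inter> C)" "indicator (C - B)"] ind_int[OF _ BC_sets(1)] BC_sets(2) CB_fin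
        by simp
      then have "\<Psi> (indicator (C - B)) x \<noteq> 0"
        using killC[OF C(1)] C(2) by (auto simp: blinfun.add_left)
      then have CB_pos: "measure \<mu> (C - B) > 0"
        using \<Psi>_indicator_nonzero BC_sets(2) CB_fin by blast
      let ?\<C> = "insert (B \<inter> C) (insert (C - B) (\<C> - {C}))"
      have ne: "B \<inter> C \<noteq> {}" "C - B \<noteq> {}"
        using positive_measureD(4)[OF BC_pos] positive_measureD(4)[OF CB_pos] .
      have disjC: "C \<inter> C' = {}" if "C' \<in> \<C> - {C}" for C'
        using \<C>(3) C(1) that unfolding disjoint_def by blast
      then have "C - B \<notin> \<C> - {C}" "B \<inter> C \<notin> insert (C - B) (\<C> - {C})" using ne by blast+
      then have "card ?\<C> = Suc (Suc (card (\<C> - {C})))" using \<C>(1) by simp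
      then have "card ?\<C> = Suc n"
        using card_Suc_Diff1[OF \<C>(1) C(1)] \<C>(2) by simp
      moreover have "disjoint ?\<C>"
        using \<C>(3) disjC unfolding disjoint_def by blast
      ultimately show ?thesis using \<C>(1) pos BC_pos CB_pos
        by (intro exI[of _ ?\<C>]) auto
    qed
  qed
  then show thesis using that by blast
qed

text \<open>
  In a large disjoint family only few members can carry a large part of the integral of \<open>G\<close>; the
  remaining ones are the wanted sets.
\<close>

lemma many_disjoint_small_integral:
  fixes G :: "'m \<Rightarrow> real"
  assumes "infinite_dimensional TYPE('x)" "integrable \<mu> G" "\<And>x. G x \<ge> 0" "e > 0"
  obtains \<C> where "finite \<C>" "card \<C> = n" "disjoint \<C>" "\<And>C. C \<in> \<C> \<Longrightarrow> measure \<mu> C > 0"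
    "\<And>C. C \<in> \<C> \<Longrightarrow> (\<integral>x. G x * indicator C x \<partial>\<mu>) < e"
proof -
  obtain m :: nat where m: "(\<integral>x. G x \<partial>\<mu>) / e \<le> real m" using real_arch_simple by blast
  obtain \<D> where \<D>: "finite \<D>" "card \<D> = n + m" "disjoint \<D>" "\<And>C. C \<in> \<D> \<Longrightarrow> measure \<mu> C > 0"
    using arbitrarily_many_disjoint_positive[OF assms(1), of "n + m"] by blast
  define I where "I C = (\<integral>x. G x * indicator C x \<partial>\<mu>)" for C
  define bad where "bad = {C \<in> \<D>. I C \<ge> e}"
  have I_nonneg: "I C \<ge> 0" for C unfolding I_def using assms(3) by (intro Bochner_Integration.integral_nonneg) auto
  have "real (card bad) * e \<le> (\<Sum>C\<in>bad. I C)"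
    using sum_bounded_below[of bad e I] by (simp add: bad_def)
  also have "\<dots> \<le> (\<Sum>C\<in>\<D>. \<bar>I C\<bar>)"
    using \<D>(1) I_nonneg by (auto simp: bad_def intro!: sum_mono2)
  also have "\<dots> \<le> (\<integral>x. \<bar>G x\<bar> \<partial>\<mu>)"
    unfolding I_def using positive_measureD(1)[OF \<D>(4)]
    by (intro sum_abs_integral_disjoint_le \<D>(1,3) assms(2))
  also have "\<dots> = (\<integral>x. G x \<partial>\<mu>)" using assms(3) by simp
  also have "\<dots> \<le> real m * e" using m assms(4) by (simp add: field_simps)
  finally have "card bad \<le> m" using assms(4) by simp
  then have "n \<le> card (\<D> - bad)"
    using \<D>(1,2) by (subst card_Diff_subset) (auto simp: bad_def)
  then obtain \<C> where \<C>: "\<C> \<subseteq> \<D> - bad" "card \<C> = n" "finite \<C>"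
    using obtain_subset_with_card_n by metis
  show thesis
  proof (rule that[OF \<C>(3,2)])
    show "disjoint \<C>" using \<D>(3) \<C>(1) unfolding disjoint_def by blast
  qed (use \<C>(1) \<D>(4) in \<open>auto simp: bad_def I_def\<close>)
qed

text \<open>
  A finite family of integrable functions can be approximated by simple functions that leave room
  for as many further disjoint sets as they have steps. The steps are cut back by sets on which the
  approximants have small integrals.
\<close>

lemma approx_disjoint_with_copies:
  fixes H :: "('m \<Rightarrow> real) set"
  assumes "infinite_dimensional TYPE('x)" "finite H" "\<And>h. h \<in> H \<Longrightarrow> integrable \<mu> h" "e > 0"
  obtains \<A> \<beta> c where "finite \<A>" "inj_on \<beta> \<A>" "disjoint (\<A> \<union> \<beta> ` \<A>)" "\<A> \<inter> \<beta> ` \<A> = {}"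
    "\<And>A. A \<in> \<A> \<union> \<beta> ` \<A> \<Longrightarrow> measure \<mu> A > 0"
    "\<And>h. h \<in> H \<Longrightarrow> (\<integral>x. \<bar>h x - (\<Sum>A\<in>\<A>. c h A * indicator A x)\<bar> \<partial>\<mu>) < e"
proof -
  obtain \<A>\<^sub>0 c\<^sub>0 where \<A>\<^sub>0: "finite \<A>\<^sub>0" "disjoint \<A>\<^sub>0" "\<And>A. A \<in> \<A>\<^sub>0 \<Longrightarrow> measure \<mu> A > 0"
    and approx: "\<And>h. h \<in> H \<Longrightarrow> (\<integral>x. \<bar>h x - (\<Sum>A\<in>\<A>\<^sub>0. c\<^sub>0 h A * indicator A x)\<bar> \<partial>\<mu>) < e / 2"
    using finite_family_approx_disjoint[OF assms(2,3), of "e / 2"] assms(4) by auto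
  define g where "g h x = (\<Sum>A\<in>\<A>\<^sub>0. c\<^sub>0 h A * indicator A x)" for h x
  define G where "G x = (\<Sum>h\<in>H. \<bar>g h x\<bar>)" for x
  define n where "n = card \<A>\<^sub>0"
  have g_int: "integrable \<mu> (g h)" for h
    unfolding g_def using positive_measureD(3)[OF \<A>\<^sub>0(3)] by auto
  have G_int: "integrable \<mu> G" unfolding G_def using g_int by auto
  have G_nonneg: "G x \<ge> 0" for x unfolding G_def by (intro sum_nonneg) auto
  have g_le_G: "\<bar>g h x\<bar> \<le> G x" if "h \<in> H" for h x
    unfolding G_def using that assms(2) by (intro member_le_sum) auto
  obtain \<C> where \<C>: "finite \<C>" "card \<C> = n" "disjoint \<C>" "\<And>C. C \<in> \<C> \<Longrightarrow> measure \<mu> C > 0"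
    and small: "\<And>C. C \<in> \<C> \<Longrightarrow> (\<integral>x. G x * indicator C x \<partial>\<mu>) < e / (2 * (n + 1))"
    using many_disjoint_small_integral[OF assms(1) G_int G_nonneg, of "e / (2 * (n + 1))" n] assms(4)
    by auto
  define D where "D = \<Union>\<C>"
  define \<A> where "\<A> = {A \<in> (\<lambda>A. A - D) ` \<A>\<^sub>0. measure \<mu> A > 0}"
  \<comment> \<open>On each of the remaining steps the approximant \<open>g h\<close> still is constant.\<close>
  define c where "c h A = g h (SOME x. x \<in> A)" for h A
  have C_sets: "C \<in> sets \<mu>" if "C \<in> \<C>" for C using positive_measureD(1)[OF \<C>(4)[OF that]] .
  have D_sets: "D \<in> sets \<mu>" unfolding D_def using C_sets \<C>(1) by auto
  have fin: "finite \<A>" using \<A>\<^sub>0(1) by (simp add: \<A>_def)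
  have "card \<A> \<le> card ((\<lambda>A. A - D) ` \<A>\<^sub>0)" unfolding \<A>_def using \<A>\<^sub>0(1) by (intro card_mono) auto
  also have "\<dots> \<le> card \<C>" using card_image_le[OF \<A>\<^sub>0(1)] \<C>(2) by (simp add: n_def)
  finally obtain \<beta> where \<beta>: "inj_on \<beta> \<A>" "\<beta> ` \<A> \<subseteq> \<C>"
    using card_le_inj[OF fin \<C>(1)] by blast
  have pos: "measure \<mu> A > 0" if "A \<in> \<A> \<union> \<beta> ` \<A>" for A
    using that \<beta>(2) \<C>(4) by (auto simp: \<A>_def)
  have disj\<A>: "disjoint \<A>" using \<A>\<^sub>0(2) unfolding \<A>_def disjoint_def by blast
  have apart: "A \<inter> C = {}" if "A \<in> \<A>" "C \<in> \<beta> ` \<A>" for A C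
    using that \<beta>(2) unfolding \<A>_def D_def by blast
  have "disjoint (\<beta> ` \<A>)" using \<C>(3) \<beta>(2) unfolding disjoint_def by blast
  then have disj: "disjoint (\<A> \<union> \<beta> ` \<A>)"
    using disj\<A> apart unfolding disjoint_def by (metis Int_commute Un_iff)
  have "\<A> \<inter> \<beta> ` \<A> = {}" using apart positive_measureD(4)[OF pos] by (metis Int_absorb disjoint_iff Un_iff)
  moreover have "(\<integral>x. \<bar>h x - (\<Sum>A\<in>\<A>. c h A * indicator A x)\<bar> \<partial>\<mu>) < e" if h: "h \<in> H" for h
  proof -
    have \<A>_sets: "A \<in> sets \<mu>" if "A \<in> \<A>" for A using positive_measureD(1)[OF pos] that by blast
    have s_int: "integrable \<mu> (\<lambda>x. \<Sum>A\<in>\<A>. c h A * indicator A x)"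
      using positive_measureD(3)[OF pos] by auto
    have GC_int: "integrable \<mu> (\<lambda>x. G x * indicator C x)" if "C \<in> \<C>" for C
      using integrable_real_mult_indicator[OF C_sets[OF that] G_int] by simp
    have "AE x in \<mu>. x \<notin> A - D" if "A \<in> \<A>\<^sub>0" "\<not> measure \<mu> (A - D) > 0" for A
    proof (rule AE_not_in)
      note A_meas = positive_measureD[OF \<A>\<^sub>0(3)[OF that(1)]]
      have "emeasure \<mu> (A - D) < \<infinity>"
        using emeasure_mono[of "A - D" A \<mu>] A_meas(1,2) by (meson Diff_subset le_less_trans)
      then have "emeasure \<mu> (A - D) = 0"
        using that(2) by (simp add: emeasure_eq_ennreal_measure not_less measure_le_0_iff)
      then show "A - D \<in> null_sets \<mu>" using A_meas(1) D_sets by auto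
    qed
    then have "AE x in \<mu>. \<forall>A\<in>\<A>\<^sub>0. \<not> measure \<mu> (A - D) > 0 \<longrightarrow> x \<notin> A - D"
      using \<A>\<^sub>0(1) by (intro AE_finite_allI) auto
    then have "AE x in \<mu>. \<bar>h x - (\<Sum>A\<in>\<A>. c h A * indicator A x)\<bar>
        \<le> \<bar>h x - g h x\<bar> + (\<Sum>C\<in>\<C>. G x * indicator C x)"
    proof (rule AE_mp, intro AE_I2 impI)
      fix x assume x: "\<forall>A\<in>\<A>\<^sub>0. \<not> measure \<mu> (A - D) > 0 \<longrightarrow> x \<notin> A - D"
      have GC_nonneg: "(\<Sum>C\<in>\<C>. G x * indicator C x) \<ge> 0"
        using G_nonneg by (intro sum_nonneg) auto
      show "\<bar>h x - (\<Sum>A\<in>\<A>. c h A * indicator A x)\<bar> \<le> \<bar>h x - g h x\<bar> + (\<Sum>C\<in>\<C>. G x * indicator C x)"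
      proof (cases "x \<in> D")
        case True
        then obtain C where C: "C \<in> \<C>" "x \<in> C" by (auto simp: D_def)
        have "(\<Sum>A\<in>\<A>. c h A * indicator A x) = 0"
          using True by (intro sum.neutral) (auto simp: \<A>_def)
        moreover have "(\<Sum>C\<in>\<C>. G x * indicator C x) = G x"
          using sum_indicator_disjoint[OF \<C>(1,3) C, of "\<lambda>_. G x"] by simp
        ultimately show ?thesis using g_le_G[OF h, of x] by simp
      next
        case False
        have "(\<Sum>A\<in>\<A>. c h A * indicator A x) = g h x"
        proof (cases "x \<in> \<Union>\<A>\<^sub>0")
          case True
          then obtain A where A: "A \<in> \<A>\<^sub>0" "x \<in> A" by blast
          then have "measure \<mu> (A - D) > 0" using x False by blast
          then have AD: "A - D \<in> \<A>" "x \<in> A - D" using A False by (auto simp: \<A>_def)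
          have g_A: "g h y = c\<^sub>0 h A" if "y \<in> A" for y
            unfolding g_def using sum_indicator_disjoint[OF \<A>\<^sub>0(1,2) A(1) that] .
          have "(SOME y. y \<in> A - D) \<in> A - D" using AD(2) by (rule someI)
          then have "c h (A - D) = g h x" using g_A A(2) by (simp add: c_def)
          then show ?thesis using sum_indicator_disjoint[OF fin disj\<A> AD, of "c h"] by simp
        next
          case False
          have "(\<Sum>A\<in>\<A>. c h A * indicator A x) = 0" using False by (intro sum.neutral) (auto simp: \<A>_def)
          moreover have "g h x = 0" unfolding g_def using False by (intro sum.neutral) auto
          ultimately show ?thesis by simp
        qed
        then show ?thesis using GC_nonneg by simp
      qed
    qed
    then have "(\<integral>x. \<bar>h x - (\<Sum>A\<in>\<A>. c h A * indicator A x)\<bar> \<partial>\<mu>)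
        \<le> (\<integral>x. \<bar>h x - g h x\<bar> + (\<Sum>C\<in>\<C>. G x * indicator C x) \<partial>\<mu>)"
      using assms(3)[OF h] s_int g_int GC_int by (intro integral_mono_AE) auto
    also have "\<dots> = (\<integral>x. \<bar>h x - g h x\<bar> \<partial>\<mu>) + (\<Sum>C\<in>\<C>. \<integral>x. G x * indicator C x \<partial>\<mu>)"
      using assms(3)[OF h] g_int GC_int by (subst Bochner_Integration.integral_add) auto
    also have "(\<Sum>C\<in>\<C>. \<integral>x. G x * indicator C x \<partial>\<mu>) \<le> real (card \<C>) * (e / (2 * (n + 1)))"
      using small by (intro sum_bounded_above) (simp add: less_imp_le)
    also have "\<dots> \<le> e / 2" using \<C>(2) assms(4) by (simp add: field_simps)
    finally show ?thesis using approx[OF h] by (simp add: g_def)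
  qed
  ultimately show thesis using that[of \<A> \<beta> c] fin \<beta>(1) disj pos by blast
qed

definition rep :: "('x \<Rightarrow>\<^sub>L real) \<Rightarrow> 'm \<Rightarrow> real"
  where "rep u = (SOME f. integrable \<mu> f \<and> \<Psi> f = u)"

lemma rep: "integrable \<mu> (rep u)" "\<Psi> (rep u) = u"
  using someI_ex[OF \<Psi>_surj[of u]] by (auto simp: rep_def)

definition integral_over :: "'m set \<Rightarrow> ('x \<Rightarrow>\<^sub>L real) \<Rightarrow> real"
  where "integral_over A u = (\<integral>x. rep u x * indicator A x \<partial>\<mu>)"

text \<open>
  The integral depends only on the functional, not on the representing function, since two
  representing functions of the same functional have \<open>L\<^sub>1\<close> distance \<open>0\<close>.
\<close>

lemma integral_over_\<Psi>:
  assumes "A \<in> sets \<mu>" "integrable \<mu> f"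
  shows "integral_over A (\<Psi> f) = (\<integral>x. f x * indicator A x \<partial>\<mu>)"
proof -
  define d where "d x = rep (\<Psi> f) x - f x" for x
  have d: "integrable \<mu> d" unfolding d_def using rep assms(2) by auto
  have "\<Psi> d = 0" unfolding d_def using \<Psi>_diff[OF rep(1) assms(2)] rep by simp
  then have "(\<integral>x. \<bar>d x\<bar> \<partial>\<mu>) = 0" using norm_\<Psi>[OF d] by simp
  then have "\<bar>\<integral>x. d x * indicator A x \<partial>\<mu>\<bar> \<le> 0"
    using sum_abs_integral_disjoint_le[of "{A}" \<mu> d] assms(1) d by simp
  moreover have "(\<integral>x. d x * indicator A x \<partial>\<mu>) = integral_over A (\<Psi> f) - (\<integral>x. f x * indicator A x \<partial>\<mu>)"
    unfolding integral_over_def d_def left_diff_distrib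
    using integrable_real_mult_indicator[OF assms(1)] rep(1) assms(2)
    by (intro Bochner_Integration.integral_diff) auto
  ultimately show ?thesis by simp
qed

lemma linear_integral_over:
  assumes "A \<in> sets \<mu>"
  shows "linear (integral_over A)"
proof (rule linearI)
  note int = integrable_real_mult_indicator[OF assms rep(1)]
  fix u v
  have "integral_over A (\<Psi> (\<lambda>x. rep u x + rep v x)) = integral_over A u + integral_over A v"
    using rep int assms by (subst integral_over_\<Psi>) (auto simp: integral_over_def distrib_right)
  then show "integral_over A (u + v) = integral_over A u + integral_over A v"
    using \<Psi>_add[OF rep(1) rep(1), of u v] rep(2) by simp
  fix c
  have "integral_over A (\<Psi> (\<lambda>x. c * rep u x)) = c * integral_over A u"
    using rep int assms by (subst integral_over_\<Psi>) (auto simp: integral_over_def mult.assoc)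
  then show "integral_over A (c *\<^sub>R u) = c *\<^sub>R integral_over A u"
    using \<Psi>_scaleR[OF rep(1), of c u] rep(2) by simp
qed

lemma abs_integral_over_le:
  assumes "finite \<A>" "disjoint \<A>" "\<And>A. A \<in> \<A> \<Longrightarrow> A \<in> sets \<mu>"
  shows "(\<Sum>A\<in>\<A>. \<bar>integral_over A u\<bar>) \<le> norm u"
  using sum_abs_integral_disjoint_le[OF assms rep(1), of u] norm_\<Psi>[OF rep(1), of u] rep(2)
  by (simp add: integral_over_def)

text \<open>
  The heart of the matter. Approximate the given functionals by simple functions with steps \<open>A\<close>, and
  choose a further disjoint set \<open>\<beta> A\<close> for each step. Since the functionals \<open>unit A\<close> and
  \<open>unit (\<beta> A)\<close> together behave like the unit vectors of \<open>\<ell>\<^sub>1\<close>, Helly's theorem yields points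
  \<open>x\<^sub>1\<close> and \<open>x\<^sub>2\<close>, hardly longer than \<open>x\<close>, at which every \<open>unit A\<close> has the same value as at
  \<open>x\<close>, whereas \<open>unit (\<beta> A)\<close> has this value at \<open>x\<^sub>1\<close> and its negative at \<open>x\<^sub>2\<close>. The operator
  \<open>Q\<close> averages over the steps and moves the result to the copies, so that it detects the difference
  \<open>x\<^sub>1 - x\<^sub>2\<close>, which the given functionals do not.
\<close>

lemma indistinguishable_separated_pairs:
  fixes V :: "('x \<Rightarrow>\<^sub>L real) set"
  assumes "infinite_dimensional TYPE('x)" "finite V" "0 < \<delta>" "\<delta> \<le> 1"
  obtains Q :: "('x \<Rightarrow>\<^sub>L real) \<Rightarrow> ('x \<Rightarrow>\<^sub>L real)" where "linear Q" "\<And>u. norm (Q u) \<le> norm u"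
    "\<And>x. \<exists>x\<^sub>1 x\<^sub>2. norm x\<^sub>1 \<le> (1 + \<delta>) * norm x \<and> norm x\<^sub>2 \<le> (1 + \<delta>) * norm x \<and>
      (\<forall>v\<in>V. \<bar>blinfun_apply v x\<^sub>1 - blinfun_apply v x\<bar> \<le> \<delta> * norm x \<and> \<bar>blinfun_apply v x\<^sub>2 - blinfun_apply v x\<bar> \<le> \<delta> * norm x \<and>
        \<bar>blinfun_apply (Q v) (x\<^sub>1 - x\<^sub>2) - 2 * blinfun_apply v x\<bar> \<le> \<delta> * norm x)"
proof -
  \<comment> \<open>An approximation error \<open>\<eta>\<close> enters the separation estimate four times.\<close>
  define \<eta> where "\<eta> = \<delta> / 4"
  have \<eta>: "\<eta> > 0" using assms(3) by (simp add: \<eta>_def)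
  have "finite (rep ` V)" "\<And>h. h \<in> rep ` V \<Longrightarrow> integrable \<mu> h" using assms(2) rep(1) by auto
  then obtain \<A> \<beta> c where \<A>: "finite \<A>" "inj_on \<beta> \<A>" "disjoint (\<A> \<union> \<beta> ` \<A>)" "\<A> \<inter> \<beta> ` \<A> = {}"
    and pos: "\<And>A. A \<in> \<A> \<union> \<beta> ` \<A> \<Longrightarrow> measure \<mu> A > 0"
    and approx: "\<And>h. h \<in> rep ` V \<Longrightarrow> (\<integral>x. \<bar>h x - (\<Sum>A\<in>\<A>. c h A * indicator A x)\<bar> \<partial>\<mu>) < \<eta>"
    by (rule approx_disjoint_with_copies[OF assms(1) _ _ \<eta>]) (assumption | rule that | blast)+
  have pos\<A>: "measure \<mu> A > 0" if "A \<in> \<A>" for A using pos that by blast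
  have pos\<beta>: "measure \<mu> (\<beta> A) > 0" if "A \<in> \<A>" for A using pos that by blast
  have \<A>_sets: "A \<in> sets \<mu>" if "A \<in> \<A>" for A using positive_measureD(1)[OF pos\<A>[OF that]] .
  have disj: "disjoint \<A>" using \<A>(3) unfolding disjoint_def by blast
  define Q where "Q u = (\<Sum>A\<in>\<A>. integral_over A u *\<^sub>R unit (\<beta> A))" for u
  have linQ: "linear Q"
    unfolding Q_def using linear_integral_over[OF \<A>_sets]
    by (intro linearI)
      (simp_all add: linear_add linear_scale scaleR_add_left sum.distrib scaleR_sum_right)
  have normQ: "norm (Q u) \<le> norm u" for u
  proof -
    have "norm (Q u) \<le> (\<Sum>A\<in>\<A>. norm (integral_over A u *\<^sub>R unit (\<beta> A)))"
      unfolding Q_def by (rule norm_sum)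
    also have "\<dots> = (\<Sum>A\<in>\<A>. \<bar>integral_over A u\<bar>)"
      using norm_unit[OF pos\<beta>] by simp
    also have "\<dots> \<le> norm u" by (rule abs_integral_over_le[OF \<A>(1) disj \<A>_sets])
    finally show ?thesis .
  qed
  \<comment> \<open>The part of \<open>v\<close> that the simple function misses.\<close>
  define w where "w v x = rep v x - (\<Sum>A\<in>\<A>. c (rep v) A * indicator A x)" for v x
  have s_int: "integrable \<mu> (\<lambda>x. \<Sum>A\<in>\<A>. c h A * indicator A x)" for h
    using positive_measureD(3)[OF pos\<A>] by auto
  have w_int: "integrable \<mu> (w v)" for v
    unfolding w_def using rep(1) s_int by auto
  have w_norm: "norm (\<Psi> (w v)) \<le> \<eta>" if "v \<in> V" for v
    using approx[of "rep v"] that norm_\<Psi>[OF w_int, of v] by (simp add: w_def)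
  have w_app: "\<bar>\<Psi> (w v) y\<bar> \<le> \<eta> * norm y" if "v \<in> V" for v y
    using norm_blinfun[of "\<Psi> (w v)" y] mult_right_mono[OF w_norm[OF that], of "norm y"] by simp
  have expand: "blinfun_apply v y = \<Psi> (w v) y + (\<Sum>A\<in>\<A>. c (rep v) A * measure \<mu> A * unit A y)" for v y
  proof -
    have "\<Psi> (w v) = v - (\<Sum>A\<in>\<A>. (c (rep v) A * measure \<mu> A) *\<^sub>R unit A)"
      unfolding w_def using \<Psi>_diff[OF rep(1) s_int] rep(2) pos\<A> by (simp add: \<Psi>_simple)
    then show ?thesis by (simp add: blinfun.diff_left blinfun.sum_left blinfun.scaleR_left)
  qed
  have coeff: "integral_over A v = integral_over A (\<Psi> (w v)) + c (rep v) A * measure \<mu> A"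
    if A: "A \<in> \<A>" for A v
  proof -
    have "v = \<Psi> (w v) + \<Psi> (\<lambda>x. \<Sum>B\<in>\<A>. c (rep v) B * indicator B x)"
      unfolding w_def using \<Psi>_diff[OF rep(1) s_int] rep(2) by simp
    then have "integral_over A v = integral_over A (\<Psi> (w v))
        + integral_over A (\<Psi> (\<lambda>x. \<Sum>B\<in>\<A>. c (rep v) B * indicator B x))"
      using linear_add[OF linear_integral_over[OF \<A>_sets[OF A]]] by metis
    also have "integral_over A (\<Psi> (\<lambda>x. \<Sum>B\<in>\<A>. c (rep v) B * indicator B x))
        = (\<integral>x. (\<Sum>B\<in>\<A>. c (rep v) B * indicator B x) * indicator A x \<partial>\<mu>)"
      by (rule integral_over_\<Psi>[OF \<A>_sets[OF A] s_int])
    also have "\<dots> = (\<integral>x. c (rep v) A * indicator A x \<partial>\<mu>)"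
    proof (rule Bochner_Integration.integral_cong[OF refl])
      fix x
      show "(\<Sum>B\<in>\<A>. c (rep v) B * indicator B x) * indicator A x = c (rep v) A * indicator A x"
        using sum_indicator_disjoint[OF \<A>(1) disj A, of x "c (rep v)"] by (cases "x \<in> A") auto
    qed
    also have "\<dots> = c (rep v) A * measure \<mu> A"
      using sets.sets_into_space[OF \<A>_sets[OF A]] by (simp add: Int_absorb2)
    finally show ?thesis .
  qed
  have "\<exists>x\<^sub>1 x\<^sub>2. norm x\<^sub>1 \<le> (1 + \<delta>) * norm x \<and> norm x\<^sub>2 \<le> (1 + \<delta>) * norm x \<and>
      (\<forall>v\<in>V. \<bar>blinfun_apply v x\<^sub>1 - blinfun_apply v x\<bar> \<le> \<delta> * norm x \<and> \<bar>blinfun_apply v x\<^sub>2 - blinfun_apply v x\<bar> \<le> \<delta> * norm x \<and>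
        \<bar>blinfun_apply (Q v) (x\<^sub>1 - x\<^sub>2) - 2 * blinfun_apply v x\<bar> \<le> \<delta> * norm x)" for x
  proof (cases "x = 0")
    case True
    then show ?thesis by (intro exI[of _ 0]) simp
  next
    case False
    have lift: "\<exists>y. norm y \<le> (1 + \<delta>) * norm x \<and> (\<forall>A\<in>\<A>. unit A y = unit A x \<and> unit (\<beta> A) y = s * unit A x)"
      if s: "\<bar>s\<bar> = 1" for s :: real
    proof -
      define d where "d D = (if D \<in> \<A> then unit D x else s * unit (inv_into \<A> \<beta> D) x)" for D
      have d\<beta>: "d (\<beta> A) = s * unit A x" if "A \<in> \<A>" for A
        using that \<A>(2,4) by (auto simp: d_def inv_into_f_f)
      have bound: "\<bar>d D\<bar> \<le> norm x" if D: "D \<in> \<A> \<union> \<beta> ` \<A>" for D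
      proof (cases "D \<in> \<A>")
        case True
        then show ?thesis using abs_unit_le[OF pos\<A>] by (simp add: d_def)
      next
        case False
        then obtain A where A: "A \<in> \<A>" "D = \<beta> A" using D by blast
        then show ?thesis using abs_unit_le[OF pos\<A>[OF A(1)], of x] s by (simp add: d\<beta> abs_mult)
      qed
      obtain y where y: "norm y \<le> (1 + \<delta>) * norm x" "\<And>D. D \<in> \<A> \<union> \<beta> ` \<A> \<Longrightarrow> unit D y = d D"
      proof (rule Helly_l1[of "\<A> \<union> \<beta> ` \<A>" unit d "norm x" "(1 + \<delta>) * norm x"])
        show "(\<Sum>D\<in>\<A> \<union> \<beta> ` \<A>. \<bar>t D\<bar>) \<le> norm (\<Sum>D\<in>\<A> \<union> \<beta> ` \<A>. t D *\<^sub>R unit D)" for t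
          using norm_sum_unit[OF _ \<A>(3) pos, of t] \<A>(1) by simp
        show "norm x < (1 + \<delta>) * norm x" using False assms(3) by simp
      qed (use \<A>(1) bound in auto)
      have "unit A y = unit A x \<and> unit (\<beta> A) y = s * unit A x" if "A \<in> \<A>" for A
        using y(2)[of A] y(2)[of "\<beta> A"] that d\<beta> by (simp add: d_def)
      then show ?thesis using y(1) by blast
    qed
    obtain x1 where x1: "norm x1 \<le> (1 + \<delta>) * norm x"
      "\<And>A. A \<in> \<A> \<Longrightarrow> unit A x1 = unit A x" "\<And>A. A \<in> \<A> \<Longrightarrow> unit (\<beta> A) x1 = unit A x"
      using lift[of 1] by auto
    obtain x2 where x2: "norm x2 \<le> (1 + \<delta>) * norm x"
      "\<And>A. A \<in> \<A> \<Longrightarrow> unit A x2 = unit A x" "\<And>A. A \<in> \<A> \<Longrightarrow> unit (\<beta> A) x2 = - unit A x"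
      using lift[of "-1"] by auto
    have close: "\<bar>blinfun_apply v y - blinfun_apply v x\<bar> \<le> \<delta> * norm x"
      if y: "norm y \<le> (1 + \<delta>) * norm x" "\<And>A. A \<in> \<A> \<Longrightarrow> unit A y = unit A x" and v: "v \<in> V" for y v
    proof -
      have "v y - v x = \<Psi> (w v) (y - x)"
        using expand[of v y] expand[of v x] y(2) by (simp add: blinfun.diff_right)
      also have "\<bar>\<dots>\<bar> \<le> \<eta> * norm (y - x)" by (rule w_app[OF v])
      also have "norm (y - x) \<le> 3 * norm x"
      proof -
        have "\<delta> * norm x \<le> 1 * norm x" using assms(4) by (intro mult_right_mono) auto
        then show ?thesis using norm_triangle_ineq4[of y x] y(1) by (simp add: algebra_simps)
      qed
      finally have "\<bar>v y - v x\<bar> \<le> \<eta> * (3 * norm x)" using \<eta> by simp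
      also have "\<dots> \<le> \<delta> * norm x" using assms(3) by (simp add: \<eta>_def)
      finally show ?thesis .
    qed
    have sep: "\<bar>blinfun_apply (Q v) (x1 - x2) - 2 * blinfun_apply v x\<bar> \<le> \<delta> * norm x" if v: "v \<in> V" for v
    proof -
      define err where "err = (\<Sum>A\<in>\<A>. integral_over A (\<Psi> (w v)) * unit A x)"
      have "Q v (x1 - x2) = (\<Sum>A\<in>\<A>. integral_over A v * (2 * unit A x))"
        unfolding Q_def blinfun.sum_left
        by (intro sum.cong) (simp_all add: blinfun.scaleR_left blinfun.diff_right x1 x2)
      also have "\<dots> = (\<Sum>A\<in>\<A>. 2 * (integral_over A (\<Psi> (w v)) * unit A x)
          + 2 * (c (rep v) A * measure \<mu> A * unit A x))"
      proof (rule sum.cong[OF refl])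
        fix A assume "A \<in> \<A>"
        from coeff[OF this, of v]
        show "integral_over A v * (2 * unit A x) = 2 * (integral_over A (\<Psi> (w v)) * unit A x)
            + 2 * (c (rep v) A * measure \<mu> A * unit A x)"
          by (simp only: algebra_simps)
      qed
      also have "\<dots> = 2 * err + 2 * (\<Sum>A\<in>\<A>. c (rep v) A * measure \<mu> A * unit A x)"
        by (simp add: sum.distrib err_def sum_distrib_left)
      also have "\<dots> = 2 * err + 2 * (v x - \<Psi> (w v) x)" using expand[of v x] by simp
      finally have eq: "Q v (x1 - x2) - 2 * v x = 2 * err - 2 * \<Psi> (w v) x" by simp
      have "\<bar>err\<bar> \<le> (\<Sum>A\<in>\<A>. \<bar>integral_over A (\<Psi> (w v))\<bar> * norm x)"
        unfolding err_def
        using abs_unit_le[OF pos\<A>]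
        by (intro order_trans[OF sum_abs] sum_mono) (auto simp: abs_mult intro!: mult_left_mono)
      also have "\<dots> \<le> norm (\<Psi> (w v)) * norm x"
        using abs_integral_over_le[OF \<A>(1) disj \<A>_sets] by (simp add: mult_right_mono flip: sum_distrib_right)
      also have "\<dots> \<le> \<eta> * norm x" by (intro mult_right_mono w_norm[OF v]) simp
      finally have "\<bar>Q v (x1 - x2) - 2 * v x\<bar> \<le> 4 * (\<eta> * norm x)"
        using w_app[OF v, of x] unfolding eq by linarith
      then show ?thesis by (simp add: \<eta>_def)
    qed
    show ?thesis
      using x1(1) x2(1) close[OF x1(1,2)] close[OF x2(1,2)] sep by blast
  qed
  then show thesis using that[OF linQ normQ] by blast
qed

end

section \<open>Elementary tensors and the projective norm\<close>

lemma elem_tensor_add_left: "(x + x') \<otimes>\<^sub>t y = x \<otimes>\<^sub>t y + x' \<otimes>\<^sub>t y"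
  by transfer (simp add: tensor_eq_def bilinear_ladd)

lemma elem_tensor_add_right: "x \<otimes>\<^sub>t (y + y') = x \<otimes>\<^sub>t y + x \<otimes>\<^sub>t y'"
  by transfer (simp add: tensor_eq_def bilinear_radd)

lemma elem_tensor_scaleR_left: "(c *\<^sub>R x) \<otimes>\<^sub>t y = c *\<^sub>R (x \<otimes>\<^sub>t y)"
  by transfer (simp add: tensor_eq_def)

lemma elem_tensor_scaleR_right: "x \<otimes>\<^sub>t (c *\<^sub>R y) = c *\<^sub>R (x \<otimes>\<^sub>t y)"
  by transfer (simp add: tensor_eq_def bilinear_lmul bilinear_rmul)

lemma elem_tensor_diff_left: "(x - x') \<otimes>\<^sub>t y = x \<otimes>\<^sub>t y - x' \<otimes>\<^sub>t y"
  using elem_tensor_add_left[of "x - x'" x' y] by simp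

lemma to_proj_tensor_scaleR: "to_proj_tensor (c *\<^sub>R u) = c *\<^sub>R to_proj_tensor u"
  by (simp add: to_proj_tensor_def scaleR_proj_tensor.abs_eq proj_rel_refl)

lemma to_proj_tensor_add: "to_proj_tensor (u + v) = to_proj_tensor u + to_proj_tensor v"
  by (simp add: to_proj_tensor_def plus_proj_tensor.abs_eq proj_rel_refl)

lemma linear_to_proj_tensor: "linear to_proj_tensor"
  by (intro linearI) (simp_all add: to_proj_tensor_add to_proj_tensor_scaleR)

lemma proj_norm_elem_tensor_le: "proj_norm (x \<otimes>\<^sub>t y) \<le> norm x * norm y"
  using proj_norm_le[of "[(x, y)]"] by simp

lemma abs_sum_list_le:
  fixes g :: "'a \<Rightarrow> 'b \<Rightarrow> real"
  assumes "\<And>x y. (x, y) \<in> set zs \<Longrightarrow> \<bar>g x y\<bar> \<le> h x y"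
  shows "\<bar>\<Sum>(x, y)\<leftarrow>zs. g x y\<bar> \<le> (\<Sum>(x, y)\<leftarrow>zs. h x y)"
  using assms
proof (induction zs)
  case (Cons z zs)
  obtain x y where z: "z = (x, y)" by (cases z)
  have "\<bar>g x y\<bar> \<le> h x y" using Cons.prems z by simp
  moreover have "\<bar>\<Sum>(x, y)\<leftarrow>zs. g x y\<bar> \<le> (\<Sum>(x, y)\<leftarrow>zs. h x y)"
    using Cons.prems by (intro Cons.IH) auto
  ultimately show ?case by (simp add: z)
qed simp

text \<open>
  Lower bounds for the projective norm come from bilinear forms, whose values do not depend on the
  representation of a tensor.
\<close>

lemma tensor_eval_le_proj_norm:
  assumes "bilinear A" "\<And>x y. \<bar>A x y\<bar> \<le> norm x * norm y"
  shows "\<bar>tensor_eval zs A\<bar> \<le> proj_norm (\<Sum>(x, y)\<leftarrow>zs. x \<otimes>\<^sub>t y)"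
proof (rule field_le_epsilon)
  fix e :: real assume "e > 0"
  then obtain ws where ws: "(\<Sum>(x, y)\<leftarrow>zs. x \<otimes>\<^sub>t y) = (\<Sum>(x, y)\<leftarrow>ws. x \<otimes>\<^sub>t y)"
    "(\<Sum>(x, y)\<leftarrow>ws. norm x * norm y) < proj_norm (\<Sum>(x, y)\<leftarrow>zs. x \<otimes>\<^sub>t y) + e"
    by (rule proj_norm_approx)
  have "tensor_eq zs ws"
    using ws(1) unfolding sum_list_elem_tensor by (simp add: tensor.abs_eq_iff)
  then have "tensor_eval zs A = (\<Sum>(x, y)\<leftarrow>ws. A x y)"
    using assms(1) by (simp add: tensor_eq_def tensor_eval_def)
  also have "\<bar>\<dots>\<bar> \<le> (\<Sum>(x, y)\<leftarrow>ws. norm x * norm y)"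
    by (rule abs_sum_list_le) (rule assms(2))
  finally show "\<bar>tensor_eval zs A\<bar> \<le> proj_norm (\<Sum>(x, y)\<leftarrow>zs. x \<otimes>\<^sub>t y) + e"
    using ws(2) by simp
qed

lemma elem_tensor_nonzero:
  fixes x :: "'a::real_normed_vector" and y :: "'b::real_normed_vector"
  assumes "x \<noteq> 0" "y \<noteq> 0"
  shows "to_proj_tensor (x \<otimes>\<^sub>t y) \<noteq> 0"
proof -
  obtain f :: "'a \<Rightarrow>\<^sub>L real" where f: "norm f \<le> 1" "f x = norm x" using Hahn_Banach_norming[of x] by blast
  obtain g :: "'b \<Rightarrow>\<^sub>L real" where g: "norm g \<le> 1" "g y = norm y" using Hahn_Banach_norming[of y] by blast
  have bil: "bilinear (\<lambda>x y. f x * g y)"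
    unfolding bilinear_def
    by (auto intro!: linearI simp: blinfun.add_right blinfun.scaleR_right algebra_simps)
  have "\<bar>f x' * g y'\<bar> \<le> norm x' * norm y'" for x' y'
  proof -
    have "\<bar>f x'\<bar> \<le> norm x'" "\<bar>g y'\<bar> \<le> norm y'"
      using norm_blinfun[of f x'] norm_blinfun[of g y']
        mult_right_mono[OF f(1), of "norm x'"] mult_right_mono[OF g(1), of "norm y'"] by auto
    then show ?thesis by (simp add: abs_mult mult_mono)
  qed
  then have "\<bar>f x * g y\<bar> \<le> proj_norm (x \<otimes>\<^sub>t y)"
    using tensor_eval_le_proj_norm[OF bil, of "[(x, y)]"] by simp
  moreover have "f x * g y > 0" using f(2) g(2) assms by simp
  ultimately have "norm (to_proj_tensor (x \<otimes>\<^sub>t y)) > 0"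
    unfolding norm_to_proj_tensor by linarith
  then show ?thesis by auto
qed

lemma functional_on_elem_tensors:
  fixes f :: "('a::real_normed_vector, 'b::real_normed_vector) proj_tensor \<Rightarrow>\<^sub>L real"
  obtains G :: "'b \<Rightarrow> ('a \<Rightarrow>\<^sub>L real)" where "linear G"
    "\<And>x y. G y x = f (to_proj_tensor (x \<otimes>\<^sub>t y))" "\<And>y. norm (G y) \<le> norm f * norm y"
proof
  define G where "G y = Blinfun (\<lambda>x. f (to_proj_tensor (x \<otimes>\<^sub>t y)))" for y
  have le: "\<bar>f (to_proj_tensor (x \<otimes>\<^sub>t y))\<bar> \<le> norm f * norm y * norm x" for x y
  proof -
    have "\<bar>f (to_proj_tensor (x \<otimes>\<^sub>t y))\<bar> \<le> norm f * proj_norm (x \<otimes>\<^sub>t y)"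
      using norm_blinfun[of f "to_proj_tensor (x \<otimes>\<^sub>t y)"] by (simp add: norm_to_proj_tensor)
    also have "\<dots> \<le> norm f * (norm x * norm y)"
      by (intro mult_left_mono proj_norm_elem_tensor_le) simp
    finally show ?thesis by (simp add: mult_ac)
  qed
  have "bounded_linear (\<lambda>x. f (to_proj_tensor (x \<otimes>\<^sub>t y)))" for y
    using le
    by (intro bounded_linear_intro[where K = "norm f * norm y"])
      (simp_all add: elem_tensor_add_left elem_tensor_scaleR_left to_proj_tensor_add
        to_proj_tensor_scaleR blinfun.add_right blinfun.scaleR_right mult_ac)
  then show app: "G y x = f (to_proj_tensor (x \<otimes>\<^sub>t y))" for x y
    by (simp add: G_def bounded_linear_Blinfun_apply)
  show "linear G"
    by (intro linearI blinfun_eqI)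
      (simp_all add: app elem_tensor_add_right elem_tensor_scaleR_right to_proj_tensor_add
        to_proj_tensor_scaleR blinfun.add_right blinfun.scaleR_right blinfun.add_left blinfun.scaleR_left)
  show "norm (G y) \<le> norm f * norm y" for y
    by (rule norm_blinfun_bound) (simp_all add: app le)
qed

lemma to_proj_tensor_sum_list:
  "to_proj_tensor (\<Sum>(x, y)\<leftarrow>zs. p x \<otimes>\<^sub>t y) = (\<Sum>(x, y)\<leftarrow>zs. to_proj_tensor (p x \<otimes>\<^sub>t y))"
  by (induction zs) (auto simp: to_proj_tensor_add linear_0[OF linear_to_proj_tensor])

lemma blinfun_sum_list:
  "blinfun_apply f (\<Sum>(x, y)\<leftarrow>zs. h x y) = (\<Sum>(x, y)\<leftarrow>zs. blinfun_apply f (h x y))"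
  by (induction zs) (auto simp: blinfun.add_right)

section \<open>Weakly open subsets of the unit ball\<close>

lemma weak_topology_neighbourhood:
  fixes z :: "'z::real_normed_vector"
  assumes "openin weak_topology T" "z \<in> T"
  obtains F :: "('z \<Rightarrow>\<^sub>L real) set" and e where "finite F" "e > 0"
    "\<forall>w. (\<forall>f\<in>F. \<bar>blinfun_apply f w - blinfun_apply f z\<bar> < e) \<longrightarrow> w \<in> T"
proof -
  have "generate_topology_on {blinfun_apply f -` U | (f :: 'z \<Rightarrow>\<^sub>L real) U. open U} T"
    using assms(1) unfolding weak_topology_def by (rule openin_topology_generated_by)
  then have "\<exists>(F :: ('z \<Rightarrow>\<^sub>L real) set) e. finite F \<and> e > 0 \<and>
      (\<forall>w. (\<forall>f\<in>F. \<bar>blinfun_apply f w - blinfun_apply f z\<bar> < e) \<longrightarrow> w \<in> T)"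
    using assms(2)
  proof (induction rule: generate_topology_on.induct)
    case Empty
    then show ?case by simp
  next
    case (Int a b)
    have "z \<in> a" "z \<in> b" using Int.prems by auto
    from Int.IH(1)[OF this(1)] obtain F :: "('z \<Rightarrow>\<^sub>L real) set" and d where F: "finite F" "d > 0"
      "\<forall>w. (\<forall>f\<in>F. \<bar>blinfun_apply f w - blinfun_apply f z\<bar> < d) \<longrightarrow> w \<in> a"
      by blast
    from Int.IH(2)[OF \<open>z \<in> b\<close>] obtain F' :: "('z \<Rightarrow>\<^sub>L real) set" and d' where F': "finite F'" "d' > 0"
      "\<forall>w. (\<forall>f\<in>F'. \<bar>blinfun_apply f w - blinfun_apply f z\<bar> < d') \<longrightarrow> w \<in> b"
      by blast
    show ?case
    proof (intro exI[of _ "F \<union> F'"] exI[of _ "min d d'"] conjI allI impI)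
      fix w assume "\<forall>f\<in>F \<union> F'. \<bar>blinfun_apply f w - blinfun_apply f z\<bar> < min d d'"
      then show "w \<in> a \<inter> b" using F(3) F'(3) by simp
    qed (use F F' in auto)
  next
    case (UN K)
    then obtain k where "k \<in> K" "z \<in> k" by blast
    from UN.IH[OF this] obtain F :: "('z \<Rightarrow>\<^sub>L real) set" and d where F: "finite F" "d > 0"
      "\<forall>w. (\<forall>f\<in>F. \<bar>blinfun_apply f w - blinfun_apply f z\<bar> < d) \<longrightarrow> w \<in> k"
      by blast
    then show ?case using \<open>k \<in> K\<close> by (intro exI[of _ F] exI[of _ d]) auto
  next
    case (Basis s)
    then obtain f :: "'z \<Rightarrow>\<^sub>L real" and U where s: "s = blinfun_apply f -` U" "open U" by blast
    have "f z \<in> U" using Basis.prems s(1) by simp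
    then obtain d where "d > 0" "\<forall>r. dist r (f z) < d \<longrightarrow> r \<in> U"
      using s(2) unfolding open_dist by metis
    then show ?case using s(1) by (intro exI[of _ "{f}"] exI[of _ d]) (auto simp: dist_real_def)
  qed
  then show thesis using that by blast
qed

text \<open>
  Adding a multiple of an elementary tensor annihilated by the given functionals changes the norm but
  not the values of these functionals.
\<close>

lemma weak_neighbourhood_almost_unit_tensor:
  fixes z :: "('a::real_normed_vector, 'b::real_normed_vector) proj_tensor" and e r :: real
  assumes "infinite_dimensional TYPE('a)" "(UNIV :: 'b set) \<noteq> {0}"
    and "norm z \<le> 1" "finite F" "e > 0" "0 < r" "r < 1"
  obtains u :: "('a, 'b) tensor" where "r \<le> proj_norm u" "proj_norm u < 1"
    "\<And>f. f \<in> F \<Longrightarrow> \<bar>blinfun_apply f (to_proj_tensor u) - f z\<bar> < e"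
proof -
  define K where "K = 1 + (\<Sum>f\<in>F. norm f)"
  have K: "norm f < K" if "f \<in> F" for f
    using member_le_sum[OF that, of norm] assms(4) by (simp add: K_def)
  have "K > 0" unfolding K_def by (intro add_pos_nonneg sum_nonneg) auto
  \<comment> \<open>Shrinking \<open>z\<close> by the factor \<open>1 - d\<close> leaves room in the open ball for an approximation up to \<open>d\<close>.\<close>
  define d where "d = min (1 / 2) (e / (2 * K))"
  have d: "d > 0" "d < 1" and dK: "K * (2 * d) \<le> e"
    using \<open>K > 0\<close> assms(5) by (auto simp: d_def min_def field_simps)
  obtain u1 where u1: "norm ((1 - d) *\<^sub>R z - to_proj_tensor u1) < d"
    using to_proj_tensor_dense[OF d(1)] by blast
  have "norm (to_proj_tensor u1) \<le> norm ((1 - d) *\<^sub>R z) + norm ((1 - d) *\<^sub>R z - to_proj_tensor u1)"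
    by (metis norm_minus_commute norm_triangle_sub)
  also have "\<dots> < (1 - d) * 1 + d"
    using u1 d assms(3) by (intro add_le_less_mono) (auto intro: mult_left_mono)
  finally have u1_norm: "norm (to_proj_tensor u1) < 1" by simp
  have "z - to_proj_tensor u1 = ((1 - d) *\<^sub>R z - to_proj_tensor u1) + d *\<^sub>R z"
    by (simp add: algebra_simps)
  also have "norm \<dots> \<le> norm ((1 - d) *\<^sub>R z - to_proj_tensor u1) + norm (d *\<^sub>R z)"
    by (rule norm_triangle_ineq)
  also have "\<dots> \<le> d + d"
    using u1 d(1) mult_left_mono[OF assms(3), of d] by (intro add_mono) auto
  finally have u1_z: "norm (z - to_proj_tensor u1) \<le> 2 * d" by simp
  have u1_F: "\<bar>f (to_proj_tensor u1) - f z\<bar> < e" if "f \<in> F" for f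
  proof -
    have "\<bar>f (to_proj_tensor u1) - f z\<bar> = norm (f (z - to_proj_tensor u1))"
      by (simp add: blinfun.diff_right abs_minus_commute)
    also have "\<dots> \<le> norm f * (2 * d)"
      by (rule order_trans[OF norm_blinfun mult_left_mono[OF u1_z]]) simp
    also have "\<dots> < K * (2 * d)" using K[OF that] d(1) by simp
    finally show ?thesis using dK by simp
  qed
  obtain y0 :: 'b where y0: "y0 \<noteq> 0" using assms(2) by blast
  obtain x :: 'a where x: "x \<noteq> 0" and kill: "\<And>f. f \<in> F \<Longrightarrow> f (to_proj_tensor (x \<otimes>\<^sub>t y0)) = 0"
  proof (rule infinite_dimensional_common_kernel[OF assms(1)])
    show "finite ((\<lambda>f x. blinfun_apply f (to_proj_tensor (x \<otimes>\<^sub>t y0))) ` F)" using assms(4) by simp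
    show "linear v" if "v \<in> (\<lambda>f (x :: 'a). blinfun_apply f (to_proj_tensor (x \<otimes>\<^sub>t y0))) ` F" for v
      using that
      by (auto intro!: linearI simp: elem_tensor_add_left elem_tensor_scaleR_left to_proj_tensor_add
          to_proj_tensor_scaleR blinfun.add_right blinfun.scaleR_right)
  qed auto
  define v where "v = to_proj_tensor (x \<otimes>\<^sub>t y0)"
  have v: "norm v > 0" using elem_tensor_nonzero[OF x y0] by (simp add: v_def)
  have "\<exists>t. r \<le> norm (to_proj_tensor u1 + t *\<^sub>R v) \<and> norm (to_proj_tensor u1 + t *\<^sub>R v) < 1"
  proof (cases "r \<le> norm (to_proj_tensor u1)")
    case True
    then show ?thesis using u1_norm by (intro exI[of _ 0]) simp
  next
    case False
    have "norm ((2 / norm v) *\<^sub>R v) \<le> norm (to_proj_tensor u1 + (2 / norm v) *\<^sub>R v) + norm (to_proj_tensor u1)"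
      by (metis add_diff_cancel_left' norm_triangle_ineq4)
    then have "r \<le> norm (to_proj_tensor u1 + (2 / norm v) *\<^sub>R v)"
      using v u1_norm assms(7) by simp
    moreover have "continuous_on {0..2 / norm v} (\<lambda>t. norm (to_proj_tensor u1 + t *\<^sub>R v))"
      by (intro continuous_intros)
    ultimately obtain t where "norm (to_proj_tensor u1 + t *\<^sub>R v) = r"
      using IVT'[of "\<lambda>t. norm (to_proj_tensor u1 + t *\<^sub>R v)" 0 r "2 / norm v"] False v
      by auto
    then show ?thesis using assms(7) by (intro exI[of _ t]) simp
  qed
  then obtain t where t: "r \<le> norm (to_proj_tensor u1 + t *\<^sub>R v)" "norm (to_proj_tensor u1 + t *\<^sub>R v) < 1"
    by blast
  have eq: "to_proj_tensor (u1 + t *\<^sub>R (x \<otimes>\<^sub>t y0)) = to_proj_tensor u1 + t *\<^sub>R v"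
    by (simp add: v_def to_proj_tensor_add to_proj_tensor_scaleR)
  show thesis
  proof (rule that)
    show "r \<le> proj_norm (u1 + t *\<^sub>R (x \<otimes>\<^sub>t y0))" "proj_norm (u1 + t *\<^sub>R (x \<otimes>\<^sub>t y0)) < 1"
      using t by (simp_all flip: norm_to_proj_tensor add: eq)
    show "\<bar>f (to_proj_tensor (u1 + t *\<^sub>R (x \<otimes>\<^sub>t y0))) - f z\<bar> < e" if "f \<in> F" for f
      using u1_F[OF that] kill[OF that] unfolding eq by (simp add: blinfun.add_right blinfun.scaleR_right v_def)
  qed
qed

text \<open>
  The two points arise from a representation of a tensor \<open>u\<close> of norm close to \<open>1\<close> by replacing
  each first factor by one or the other member of a pair as in
  \<open>indistinguishable_separated_pairs\<close>. Since \<open>u\<close> has norm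
  less than \<open>1\<close>, the representation may be chosen with cost less than \<open>1\<close>, and this slack absorbs
  the small growth of the first factors.
\<close>

lemma weak_neighbourhood_distant_points:
  fixes z :: "('x::banach, 'y::banach) proj_tensor" and e \<epsilon> :: real
  assumes "L1_predual TYPE('m) TYPE('x)" "infinite_dimensional TYPE('x)" "(UNIV :: 'y set) \<noteq> {0}"
    and "norm z \<le> 1" "finite F" "e > 0" "0 < \<epsilon>" "\<epsilon> < 1"
  obtains w\<^sub>1 w\<^sub>2 where "norm w\<^sub>1 \<le> 1" "norm w\<^sub>2 \<le> 1" "2 - \<epsilon> \<le> norm (w\<^sub>1 - w\<^sub>2)"
    "\<And>f. f \<in> F \<Longrightarrow> \<bar>blinfun_apply f w\<^sub>1 - f z\<bar> < e" "\<And>f. f \<in> F \<Longrightarrow> \<bar>blinfun_apply f w\<^sub>2 - f z\<bar> < e"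
proof -
  obtain \<mu> :: "'m measure" and \<Psi> :: "('m \<Rightarrow> real) \<Rightarrow> ('x \<Rightarrow>\<^sub>L real)" where "L1_dual \<mu> \<Psi>"
    using L1_predual_imp_L1_dual[OF assms(1)] by blast
  then interpret L1_dual \<mu> \<Psi> .
  obtain u :: "('x, 'y) tensor" where u: "1 - \<epsilon> / 4 \<le> proj_norm u" "proj_norm u < 1"
    and u_F: "\<And>f. f \<in> F \<Longrightarrow> \<bar>blinfun_apply f (to_proj_tensor u) - f z\<bar> < e / 2"
    by (rule weak_neighbourhood_almost_unit_tensor[OF assms(2-5), of "e / 2" "1 - \<epsilon> / 4"])
      (use assms(6-8) in auto)
  obtain zs where zs: "u = (\<Sum>(x, y)\<leftarrow>zs. x \<otimes>\<^sub>t y)"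
    and "(\<Sum>(x, y)\<leftarrow>zs. norm x * norm y) < proj_norm u + (1 - proj_norm u)"
    by (rule proj_norm_approx[of "1 - proj_norm u" u]) (use u(2) in auto)
  define \<kappa> where "\<kappa> = (\<Sum>(x, y)\<leftarrow>zs. norm x * norm y)"
  have \<kappa>: "0 \<le> \<kappa>" "\<kappa> < 1"
    using \<open>_ < proj_norm u + (1 - proj_norm u)\<close> rep_cost_nonneg by (auto simp: \<kappa>_def)
  obtain \<phi> :: "('x, 'y) proj_tensor \<Rightarrow>\<^sub>L real" where \<phi>: "norm \<phi> \<le> 1" "\<phi> (to_proj_tensor u) = proj_norm u"
    using Hahn_Banach_norming[of "to_proj_tensor u"] by (auto simp: norm_to_proj_tensor)
  have "\<exists>G :: 'y \<Rightarrow> ('x \<Rightarrow>\<^sub>L real). linear G \<and>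
      (\<forall>x y. blinfun_apply (G y) x = f (to_proj_tensor (x \<otimes>\<^sub>t y))) \<and> (\<forall>y. norm (G y) \<le> norm f * norm y)"
    for f :: "('x, 'y) proj_tensor \<Rightarrow>\<^sub>L real"
    by (rule functional_on_elem_tensors[of f]) blast
  then obtain G :: "(('x, 'y) proj_tensor \<Rightarrow>\<^sub>L real) \<Rightarrow> 'y \<Rightarrow> ('x \<Rightarrow>\<^sub>L real)"
    where G: "\<And>f. linear (G f)" "\<And>f x y. G f y x = f (to_proj_tensor (x \<otimes>\<^sub>t y))"
      "\<And>f y. norm (G f y) \<le> norm f * norm y"
    by metis
  define V where "V = (\<lambda>(f, x, y). G f y) ` (insert \<phi> F \<times> set zs)"
  have "finite V" using assms(5) by (simp add: V_def)
  have V: "G f y \<in> V" if "f \<in> insert \<phi> F" "(x, y) \<in> set zs" for f x y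
    unfolding V_def by (rule image_eqI[of _ _ "(f, x, y)"]) (use that in auto)
  define S where "S = (\<Sum>(x, y)\<leftarrow>zs. norm x)"
  have S: "S \<ge> 0" unfolding S_def by (rule sum_list_nonneg) auto
  \<comment> \<open>The first bound keeps the cost below \<open>1\<close>, the second one keeps the new points in the
    neighbourhood, and the third one controls the loss in their distance.\<close>
  define \<delta> where "\<delta> = min (1 - \<kappa>) (min (e / (4 * (S + 1))) (\<epsilon> / (2 * (S + 1))))"
  have \<delta>: "0 < \<delta>" "\<delta> \<le> 1" "\<delta> \<le> 1 - \<kappa>"
    using \<kappa> S assms(6,7) by (auto simp: \<delta>_def)
  have "\<delta> * (S + 1) \<le> e / 4" "\<delta> * (S + 1) \<le> \<epsilon> / 2"
  proof -
    have "\<delta> \<le> e / (4 * (S + 1))" "\<delta> \<le> \<epsilon> / (2 * (S + 1))" by (auto simp: \<delta>_def)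
    then show "\<delta> * (S + 1) \<le> e / 4" "\<delta> * (S + 1) \<le> \<epsilon> / 2" using S by (simp_all add: field_simps)
  qed
  then have \<delta>S: "\<delta> * S < e / 2" "\<delta> * S \<le> \<epsilon> / 2"
    using \<delta>(1) assms(6) by (simp_all add: distrib_left)
  obtain Q :: "('x \<Rightarrow>\<^sub>L real) \<Rightarrow> ('x \<Rightarrow>\<^sub>L real)" where Q: "linear Q" "\<And>u. norm (Q u) \<le> norm u"
    and pairs: "\<And>x. \<exists>x\<^sub>1 x\<^sub>2. norm x\<^sub>1 \<le> (1 + \<delta>) * norm x \<and> norm x\<^sub>2 \<le> (1 + \<delta>) * norm x \<and>
      (\<forall>v\<in>V. \<bar>blinfun_apply v x\<^sub>1 - blinfun_apply v x\<bar> \<le> \<delta> * norm x \<and> \<bar>blinfun_apply v x\<^sub>2 - blinfun_apply v x\<bar> \<le> \<delta> * norm x \<and>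
        \<bar>blinfun_apply (Q v) (x\<^sub>1 - x\<^sub>2) - 2 * blinfun_apply v x\<bar> \<le> \<delta> * norm x)"
    by (rule indistinguishable_separated_pairs[OF assms(2) \<open>finite V\<close> \<delta>(1,2)])
      (assumption | rule that | blast)+
  obtain p\<^sub>1 p\<^sub>2 where p_norm: "\<And>x. norm (p\<^sub>1 x) \<le> (1 + \<delta>) * norm x" "\<And>x. norm (p\<^sub>2 x) \<le> (1 + \<delta>) * norm x"
    and p_V: "\<And>v x. v \<in> V \<Longrightarrow> \<bar>blinfun_apply v (p\<^sub>1 x) - blinfun_apply v x\<bar> \<le> \<delta> * norm x" "\<And>v x. v \<in> V \<Longrightarrow> \<bar>blinfun_apply v (p\<^sub>2 x) - blinfun_apply v x\<bar> \<le> \<delta> * norm x"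
    and p_Q: "\<And>v x. v \<in> V \<Longrightarrow> \<bar>blinfun_apply (Q v) (p\<^sub>1 x - p\<^sub>2 x) - 2 * blinfun_apply v x\<bar> \<le> \<delta> * norm x"
    using pairs by metis
  define w where "w p = (\<Sum>(x, y)\<leftarrow>zs. to_proj_tensor (p x \<otimes>\<^sub>t y))" for p :: "'x \<Rightarrow> 'x"
  have \<delta>_sum: "(\<Sum>(x, y)\<leftarrow>zs. \<delta> * norm x) = \<delta> * S"
    unfolding S_def by (induction zs) (auto simp: distrib_left)
  have u_w: "to_proj_tensor u = w (\<lambda>x. x)"
    unfolding zs w_def by (rule to_proj_tensor_sum_list)
  have w_norm: "norm (w p) \<le> 1" if p: "\<And>x. norm (p x) \<le> (1 + \<delta>) * norm x" for p
  proof -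
    have "norm (w p) \<le> (\<Sum>(x, y)\<leftarrow>zs. (1 + \<delta>) * (norm x * norm y))"
      unfolding w_def
    proof (induction zs)
      case (Cons a zs)
      obtain x y where a: "a = (x, y)" by (cases a)
      have "norm (to_proj_tensor (p x \<otimes>\<^sub>t y)) \<le> norm (p x) * norm y"
        by (simp add: norm_to_proj_tensor proj_norm_elem_tensor_le)
      also have "\<dots> \<le> (1 + \<delta>) * (norm x * norm y)"
        using mult_right_mono[OF p, of "norm y" x] by (simp add: mult.assoc)
      finally show ?case using Cons by (auto simp: a intro: norm_triangle_mono)
    qed simp
    also have "\<dots> = (1 + \<delta>) * \<kappa>"
      unfolding \<kappa>_def by (induction zs) (auto simp: distrib_left)
    also have "\<dots> \<le> 1"
    proof -
      have "\<delta> * \<kappa> \<le> \<delta> * 1" using \<kappa> \<delta>(1) by (intro mult_left_mono) auto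
      then show ?thesis using \<delta>(3) by (simp add: algebra_simps)
    qed
    finally show ?thesis .
  qed
  have w_F: "\<bar>f (w p) - f z\<bar> < e"
    if p: "\<And>v x. v \<in> V \<Longrightarrow> \<bar>blinfun_apply v (p x) - blinfun_apply v x\<bar> \<le> \<delta> * norm x" and f: "f \<in> F" for p f
  proof -
    have "f (w p) - f (to_proj_tensor u) = (\<Sum>(x, y)\<leftarrow>zs. G f y (p x) - G f y x)"
      unfolding u_w w_def blinfun_sum_list G(2) by (induction zs) auto
    also have "\<bar>\<dots>\<bar> \<le> (\<Sum>(x, y)\<leftarrow>zs. \<delta> * norm x)"
      by (rule abs_sum_list_le) (use p V f in blast)
    finally show ?thesis using u_F[OF f] \<delta>S(1) \<delta>_sum by linarith
  qed
  have "2 - \<epsilon> \<le> norm (w p\<^sub>1 - w p\<^sub>2)"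
  proof -
    \<comment> \<open>The norming functional of \<open>u\<close>, read on the copies.\<close>
    define A where "A x y = Q (G \<phi> y) x" for x y
    define zs' where "zs' = map (\<lambda>(x, y). (p\<^sub>1 x - p\<^sub>2 x, y)) zs"
    have "bilinear A"
      unfolding bilinear_def A_def using G(1)[of \<phi>] Q(1)
      by (auto intro!: linearI simp: linear_add linear_scale blinfun.add_left blinfun.scaleR_left
          blinfun.add_right blinfun.scaleR_right)
    moreover have "\<bar>A x y\<bar> \<le> norm x * norm y" for x y
    proof -
      have "\<bar>A x y\<bar> \<le> norm (Q (G \<phi> y)) * norm x"
        using norm_blinfun[of "Q (G \<phi> y)" x] by (simp add: A_def)
      also have "\<dots> \<le> norm (G \<phi> y) * norm x" by (intro mult_right_mono Q(2)) simp
      also have "\<dots> \<le> (norm \<phi> * norm y) * norm x" by (intro mult_right_mono G(3)) simp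
      also have "\<dots> \<le> (1 * norm y) * norm x" by (intro mult_right_mono \<phi>(1)) simp_all
      finally show ?thesis by (simp add: mult.commute)
    qed
    ultimately have "\<bar>tensor_eval zs' A\<bar> \<le> proj_norm (\<Sum>(x, y)\<leftarrow>zs'. x \<otimes>\<^sub>t y)"
      by (rule tensor_eval_le_proj_norm)
    also have "\<dots> = norm (w p\<^sub>1 - w p\<^sub>2)"
    proof -
      have "w p\<^sub>1 - w p\<^sub>2 = to_proj_tensor (\<Sum>(x, y)\<leftarrow>zs'. x \<otimes>\<^sub>t y)"
        unfolding w_def zs'_def
        by (induction zs) (auto simp: linear_0[OF linear_to_proj_tensor] to_proj_tensor_add
            elem_tensor_diff_left to_proj_tensor_diff algebra_simps)
      then show ?thesis by (simp add: norm_to_proj_tensor)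
    qed
    finally have "\<bar>tensor_eval zs' A\<bar> \<le> norm (w p\<^sub>1 - w p\<^sub>2)" .
    moreover have "\<bar>tensor_eval zs' A - 2 * \<phi> (to_proj_tensor u)\<bar> \<le> \<delta> * S"
    proof -
      have "tensor_eval zs' A - 2 * \<phi> (to_proj_tensor u)
          = (\<Sum>(x, y)\<leftarrow>zs. Q (G \<phi> y) (p\<^sub>1 x - p\<^sub>2 x) - 2 * G \<phi> y x)"
        unfolding u_w w_def zs'_def blinfun_sum_list G(2) A_def by (induction zs) auto
      also have "\<bar>\<dots>\<bar> \<le> (\<Sum>(x, y)\<leftarrow>zs. \<delta> * norm x)"
        by (rule abs_sum_list_le) (use p_Q V in blast)
      finally show ?thesis using \<delta>_sum by simp
    qed
    ultimately show ?thesis using \<phi>(2) u(1) \<delta>S(2) by linarith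
  qed
  then show thesis
    using that[of "w p\<^sub>1" "w p\<^sub>2"] w_norm p_norm w_F p_V by blast
qed

theorem theorem4p1:
  assumes "L1_predual TYPE('m) TYPE('x::banach)"
    and "infinite_dimensional TYPE('x)"
    and "(UNIV :: 'y::banach set) \<noteq> {0}"
  shows "diameter_two_property TYPE(('x, 'y) proj_tensor)"
  unfolding diameter_two_property_def
proof (intro allI impI, elim conjE)
  fix W :: "('x, 'y) proj_tensor set"
  assume W: "openin (subtopology weak_topology (cball 0 1)) W" and "W \<noteq> {}"
  obtain T where T: "openin weak_topology T" "W = T \<inter> cball 0 1"
    using W by (auto simp: openin_subtopology)
  obtain z where z: "z \<in> T" "norm z \<le> 1" using \<open>W \<noteq> {}\<close> T(2) by auto
  obtain F :: "(('x, 'y) proj_tensor \<Rightarrow>\<^sub>L real) set" and e where F: "finite F" "e > 0"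
    and nhd: "\<forall>w. (\<forall>f\<in>F. \<bar>blinfun_apply f w - blinfun_apply f z\<bar> < e) \<longrightarrow> w \<in> T"
    using weak_topology_neighbourhood[OF T(1) z(1)] by blast
  have "diameter W \<le> 2"
  proof (rule diameter_le)
    fix v w assume "v \<in> W" "w \<in> W"
    then have "norm v \<le> 1" "norm w \<le> 1" using T(2) by auto
    then show "norm (v - w) \<le> 2" using norm_triangle_ineq4[of v w] by linarith
  qed simp
  moreover have "2 \<le> diameter W"
  proof (rule ccontr)
    assume "\<not> 2 \<le> diameter W"
    define \<epsilon> where "\<epsilon> = min (1 / 2) ((2 - diameter W) / 2)"
    have \<epsilon>: "0 < \<epsilon>" "\<epsilon> < 1" "\<epsilon> < 2 - diameter W" using \<open>\<not> 2 \<le> diameter W\<close> by (auto simp: \<epsilon>_def min_def)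
    obtain w\<^sub>1 w\<^sub>2 where w: "norm w\<^sub>1 \<le> 1" "norm w\<^sub>2 \<le> 1" "2 - \<epsilon> \<le> norm (w\<^sub>1 - w\<^sub>2)"
      "\<And>f. f \<in> F \<Longrightarrow> \<bar>blinfun_apply f w\<^sub>1 - f z\<bar> < e" "\<And>f. f \<in> F \<Longrightarrow> \<bar>blinfun_apply f w\<^sub>2 - f z\<bar> < e"
      using weak_neighbourhood_distant_points[OF assms z(2) F \<epsilon>(1,2)] by blast
    have "w\<^sub>1 \<in> W" "w\<^sub>2 \<in> W" using nhd w T(2) by auto
    moreover have "bounded W" using T(2) by (simp add: bounded_Int)
    ultimately have "norm (w\<^sub>1 - w\<^sub>2) \<le> diameter W"
      using diameter_bounded_bound[of W w\<^sub>1 w\<^sub>2] by (simp add: dist_norm)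
    then show False using w(3) \<epsilon>(3) by linarith
  qed
  ultimately show "diameter W = 2" by simp
qed

end
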